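(* Let $K$ be a field of characteristic $0$, let $n\ge1$ and $0\le m\le n-1$ be integers, and let $r_0,\dots,r_n$ be any positive integers. In $K[x_0,\dots,x_n]$ put $$\widetilde{h_i}=x_0^{r_0}\cdots\widehat{x_i^{r_i}}\cdots x_n^{r_n}\ (0\le i\le n),\qquad \widetilde{f_1}=\sum_{i=m+1}^n\widetilde{h_i},\qquad \widetilde{f_2}=\sum_{i=0}^m\widetilde{h_i}.$$ (i) The divisor in affine space $\mathbb{A}^{n+1}$ defined by $$(\widetilde{f_1}\widetilde{f_2})^{\mathrm{red}}=x_0\cdots x_n\left(\sum_{i=0}^m x_0^{r_0}\cdots\widehat{x_i^{r_i}}\cdots x_m^{r_m}\right)\left(\sum_{i=m+1}^n x_{m+1}^{r_{m+1}}\cdots\widehat{x_i^{r_i}}\cdots x_n^{r_n}\right)$$ is free. (ii) Let $k\ge3$ and let $[a_i;b_i]\in\mathbb{P}^1$, $3\le i\le k$, be such that the $k-2$ hypersurfaces $V(a_i\widetilde{f_1}+b_i\widetilde{f_2})\subset\mathbb{A}^{n+1}$ correspond to general distinct points of the line $L_{\widetilde{f_1},\widetilde{f_2}}$. Then the divisor in $\mathbb{A}^{n+1}$ defined by $$(\widetilde{f_1}\widetilde{f_2})^{\mathrm{red}}\prod_{i=3}^k(a_i\widetilde{f_1}+b_i\widetilde{f_2})$$ is free.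
   Context: A hat means the factor is omitted; empty products equal $1$. For a polynomial $f$, $f^{\mathrm{red}}$ is the product of its distinct irreducible factors. Let $V$ be the $K$-vector space of polynomials in $K[x_0,\dots,x_n]$ of degree at most $\max(\deg\widetilde{f_1},\deg\widetilde{f_2})$. The subspace spanned by $\widetilde{f_1},\widetilde{f_2}$ gives a line $L_{\widetilde{f_1},\widetilde{f_2}}\cong\mathbb{P}^1$ in the projective space of $V$, whose point $[a;b]$ corresponds to $a\widetilde{f_1}+b\widetilde{f_2}$. "General distinct points" means pairwise distinct points with $([a_3;b_3],\dots,[a_k;b_k])$ in some non-empty Zariski-open subset of $(\mathbb{P}^1)^{k-2}$ (in particular all $a_i,b_i$ are non-zero). For a reduced polynomial $f\in R=K[x_0,\dots,x_n]$, the divisor in $\mathbb{A}^{n+1}$ defined by $f$ is free if $\mathrm{Der}(f)=\{\delta\in\mathrm{Der}_K(R):\delta(f)\in Rf\}$ is a free $R$-module. *)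

theory Defs
  imports
    Complex_Main
    "HOL-Library.Poly_Mapping"
    "HOL-Library.Function_Algebras"
    "HOL-Library.FuncSet"
    "HOL-Computational_Algebra.Squarefree"
begin

section \<open>Polynomial rings\<close>

text \<open>Polynomials over \<open>'k\<close> in variables indexed by the type \<open>'i\<close>: finitely supported maps from
  exponent vectors to coefficients, with the convolution product of \<^theory>\<open>HOL-Library.Poly_Mapping\<close>.\<close>

type_synonym ('i, 'k) mpoly = "('i \<Rightarrow>\<^sub>0 nat) \<Rightarrow>\<^sub>0 'k"

definition Const :: "'k::comm_ring_1 \<Rightarrow> ('i, 'k) mpoly" where
  "Const c = Poly_Mapping.single 0 c"

definition Var :: "'i \<Rightarrow> ('i, 'k::comm_ring_1) mpoly" where
  "Var i = Poly_Mapping.single (Poly_Mapping.single i 1) 1"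

definition eval_mpoly :: "('i \<Rightarrow> 'k) \<Rightarrow> ('i, 'k::comm_ring_1) mpoly \<Rightarrow> 'k" where
  "eval_mpoly \<rho> p = (\<Sum>e\<in>Poly_Mapping.keys p. Poly_Mapping.lookup p e *
     (\<Prod>i\<in>Poly_Mapping.keys e. \<rho> i ^ Poly_Mapping.lookup e i))"

text \<open>\<open>g\<close> is the product of the distinct irreducible factors of \<open>f\<close>. Irreducible factors are only
  determined up to units, so this is a relation: one representative is chosen from each class of
  associated irreducible factors.\<close>

definition is_red :: "'a::comm_ring_1 \<Rightarrow> 'a \<Rightarrow> bool" where
  "is_red f g \<longleftrightarrow> (\<exists>S. finite S \<and> (\<forall>p\<in>S. irreducible p \<and> p dvd f) \<and>
     (\<forall>q. irreducible q \<and> q dvd f \<longrightarrow> (\<exists>!p. p \<in> S \<and> p dvd q \<and> q dvd p)) \<and>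
     g = \<Prod>S)"


section \<open>Logarithmic derivations and free divisors\<close>

definition derivation :: "(('i, 'k::comm_ring_1) mpoly \<Rightarrow> ('i, 'k) mpoly) \<Rightarrow> bool" where
  "derivation \<delta> \<longleftrightarrow> (\<forall>p q. \<delta> (p + q) = \<delta> p + \<delta> q) \<and>
     (\<forall>c p. \<delta> (Const c * p) = Const c * \<delta> p) \<and>
     (\<forall>p q. \<delta> (p * q) = p * \<delta> q + q * \<delta> p)"

definition Der :: "('i, 'k::comm_ring_1) mpoly \<Rightarrow> (('i, 'k) mpoly \<Rightarrow> ('i, 'k) mpoly) set" where
  "Der f = {\<delta>. derivation \<delta> \<and> f dvd \<delta> f}"

text \<open>All self-maps of a commutative ring \<open>R\<close> form an \<open>R\<close>-module under pointwise operations;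
  \<open>Der f\<close> is a submodule of it.\<close>

definition fun_scale :: "'a::comm_ring_1 \<Rightarrow> ('b \<Rightarrow> 'a) \<Rightarrow> ('b \<Rightarrow> 'a)" where
  "fun_scale r \<delta> = (\<lambda>p. r * \<delta> p)"

global_interpretation fun_module: module "fun_scale :: 'a::comm_ring_1 \<Rightarrow> ('b \<Rightarrow> 'a) \<Rightarrow> ('b \<Rightarrow> 'a)"
  by standard (simp_all add: fun_scale_def fun_eq_iff algebra_simps)

lemma subspace_Der: "fun_module.subspace (Der f)"
  unfolding fun_module.subspace_def
proof (intro conjI ballI allI)
  show "0 \<in> Der f" by (simp add: Der_def derivation_def)
next
  fix \<delta> \<epsilon> assume "\<delta> \<in> Der f" "\<epsilon> \<in> Der f"
  then show "\<delta> + \<epsilon> \<in> Der f" by (auto simp: Der_def derivation_def algebra_simps)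
next
  fix r \<delta> assume "\<delta> \<in> Der f"
  then show "fun_scale r \<delta> \<in> Der f"
    by (auto simp: Der_def derivation_def fun_scale_def algebra_simps)
qed

definition free_submodule :: "('b \<Rightarrow> 'a::comm_ring_1) set \<Rightarrow> bool" where
  "free_submodule M \<longleftrightarrow> (\<exists>B. fun_module.independent B \<and> fun_module.span B = M)"

definition free_divisor :: "('i, 'k::comm_ring_1) mpoly \<Rightarrow> bool" where
  "free_divisor f \<longleftrightarrow> squarefree f \<and> free_submodule (Der f)"


section \<open>The Zariski topology on a product of projective lines\<close>

text \<open>The point \<open>[a;b]\<close> is the class of its representatives, that is, the punctured line through
  \<open>(a, b)\<close>.\<close>

definition proj_point :: "'k::field \<Rightarrow> 'k \<Rightarrow> ('k \<times> 'k) set" where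
  "proj_point a b = {(c * a, c * b) | c. c \<noteq> 0}"

definition proj_line :: "('k::field \<times> 'k) set set" where
  "proj_line = {proj_point a b | a b. (a, b) \<noteq> (0, 0)}"

definition proj_tuples :: "nat set \<Rightarrow> (nat \<Rightarrow> ('k::field \<times> 'k) set) set" where
  "proj_tuples I = (\<Pi>\<^sub>E i\<in>I. proj_line)"

text \<open>The homogeneous coordinates on the \<open>i\<close>-th factor are the variables \<open>Inl i\<close> (for \<open>a\<close>) and
  \<open>Inr i\<close> (for \<open>b\<close>). A multihomogeneous polynomial is homogeneous in each of these pairs
  separately, so that its vanishing does not depend on the representatives.\<close>

definition multihomogeneous :: "nat set \<Rightarrow> (nat + nat, 'k::field) mpoly \<Rightarrow> bool" where
  "multihomogeneous I p \<longleftrightarrow> (\<exists>d :: nat \<Rightarrow> nat. \<forall>e\<in>Poly_Mapping.keys p.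
     Poly_Mapping.keys e \<subseteq> Inl ` I \<union> Inr ` I \<and>
     (\<forall>i\<in>I. Poly_Mapping.lookup e (Inl i) + Poly_Mapping.lookup e (Inr i) = d i))"

definition vanishes_at ::
  "nat set \<Rightarrow> (nat + nat, 'k::field) mpoly \<Rightarrow> (nat \<Rightarrow> ('k \<times> 'k) set) \<Rightarrow> bool" where
  "vanishes_at I p P \<longleftrightarrow>
     (\<forall>a b. (\<forall>i\<in>I. (a i, b i) \<in> P i) \<longrightarrow> eval_mpoly (case_sum a b) p = 0)"

definition zariski_closed :: "nat set \<Rightarrow> (nat \<Rightarrow> ('k::field \<times> 'k) set) set \<Rightarrow> bool" where
  "zariski_closed I Z \<longleftrightarrow> (\<exists>F. (\<forall>p\<in>F. multihomogeneous I p) \<and>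
     Z = {P \<in> proj_tuples I. \<forall>p\<in>F. vanishes_at I p P})"

definition zariski_open :: "nat set \<Rightarrow> (nat \<Rightarrow> ('k::field \<times> 'k) set) set \<Rightarrow> bool" where
  "zariski_open I U \<longleftrightarrow> U \<subseteq> proj_tuples I \<and> zariski_closed I (proj_tuples I - U)"

end

theory Submission
  imports Defs "HOL-Computational_Algebra.Polynomial"
begin

text \<open>
  Put \<open>y i = x i ^ r i\<close> and \<open>\<theta> i = x i \<partial>/\<partial>x i / r i\<close>, so that \<open>\<theta> i\<close> fixes \<open>y i\<close> and kills the other
  \<open>y j\<close>. A derivation preserving all ideals \<open>(x i)\<close> is \<open>\<delta> = \<Sum>c i \<theta> i\<close>. Let \<open>G = {0..m}\<close>, and let
  \<open>g2\<close> and \<open>g1\<close> be the two sums in \<open>F\<close>, over \<open>G\<close> and its complement, with summands \<open>hat i\<close>.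
  Then \<open>\<delta>\<close> preserves \<open>(g2)\<close> iff \<open>\<Sum>c i hat i = e2 g2\<close> (sum over \<open>G\<close>) for some \<open>e2\<close>, and likewise \<open>(g1)\<close>
  with some \<open>e1\<close>; given this, it preserves \<open>(a f1 + b f2)\<close> iff \<open>a f1 + b f2\<close> divides \<open>e1 - e2\<close>.
  As \<open>y i\<close> divides every \<open>hat j\<close> with \<open>j \<noteq> i\<close> and is coprime to \<open>hat i\<close>, the first condition
  says \<open>c i = e2 + d i y i\<close> with \<open>\<Sum>d i = 0\<close>. So, with \<open>Q\<close> the product of the members of the pencil,
  logarithmic derivations are freely parametrized by \<open>e2\<close>, \<open>(e1 - e2) / Q\<close>, and all but one of the \<open>d i\<close>
  in each group. Squarefreeness follows from \<open>\<theta> i (a f1 + b f2) = a f1 + b f2 - b hat i\<close> for \<open>i \<in> G\<close>,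
  so the only generality needed is that all coordinates are nonzero.

  The remaining ingredient is that irreducible polynomials are prime, by induction on the
  set of variables: pseudo-division in one variable replaces the passage to a fraction field
  in Gauss' lemma.
\<close>

section \<open>Induction principles and constants of polynomial rings\<close>

lemma mpoly_induct [case_names zero single add]:
  assumes "Q 0" "\<And>e c. Q (Poly_Mapping.single e c)" "\<And>p q. Q p \<Longrightarrow> Q q \<Longrightarrow> Q (p + q)"
  shows "Q (p :: 'a \<Rightarrow>\<^sub>0 'b::comm_monoid_add)"
proof (induction p rule: Poly_Mapping.update_induct)
  case const
  then show ?case using assms(1) by simp
next
  case (update f a b)
  have "Poly_Mapping.update a b f = f + Poly_Mapping.single a b"
    using update(1) by (intro poly_mapping_eqI)
      (auto simp: lookup_update lookup_add lookup_single when_def in_keys_iff)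
  then show ?case using assms update by metis
qed

lemma Const_mult: "Const (a * b) = Const a * Const b"
  by (simp add: Const_def mult_single)

lemma Const_add: "Const (a + b) = Const a + Const b"
  by (simp add: Const_def single_add)

lemma Const_0 [simp]: "Const 0 = 0" and Const_1 [simp]: "Const 1 = 1"
  by (simp_all add: Const_def)

lemma Const_eq_0_iff [simp]: "Const c = 0 \<longleftrightarrow> c = 0"
  by (metis Const_0 Const_def inj_single injD)

lemma Const_dvd_1:
  "c \<noteq> 0 \<Longrightarrow> (Const c :: ('i, 'k::field) mpoly) dvd 1"
  by (rule dvdI[of _ _ "Const (inverse c)"]) (simp flip: Const_mult)

lemma Const_unit_dvd_iff:
  fixes p :: "('i, 'k::field) mpoly"
  assumes "c \<noteq> 0"
  shows "p dvd Const c * q \<longleftrightarrow> p dvd q"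
proof
  assume "p dvd Const c * q"
  then have "p dvd Const (inverse c) * (Const c * q)" by (rule dvd_mult)
  also have "Const (inverse c) * (Const c * q) = q"
    using assms by (simp add: mult.assoc[symmetric] Const_mult[symmetric])
  finally show "p dvd q" .
qed (rule dvd_mult)

lemma Var_power: "Var i ^ k = Poly_Mapping.single (Poly_Mapping.single i k) 1"
  by (induction k) (simp_all add: Var_def mult_single flip: single_add)

text \<open>Constants and variables generate the ring. An exponent vector is itself a finitely
  supported map, so \<open>mpoly_induct\<close> is used twice: on the polynomial and, for a single
  monomial, on its exponents.\<close>

lemma mpoly_var_induct [case_names Const Var add mult]:
  assumes "\<And>c. Q (Const c)" "\<And>i. Q (Var i)"
    "\<And>p q. Q p \<Longrightarrow> Q q \<Longrightarrow> Q (p + q)" "\<And>p q. Q p \<Longrightarrow> Q q \<Longrightarrow> Q (p * q)"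
  shows "Q (p :: ('i, 'k::comm_ring_1) mpoly)"
proof (induction p rule: mpoly_induct)
  case zero
  then show ?case using assms(1)[of 0] by simp
next
  case (single e c)
  have "Q (Poly_Mapping.single e 1)"
  proof (induction e rule: mpoly_induct)
    case zero
    then show ?case using assms(1)[of 1] by (simp add: Const_def)
  next
    case (single i k)
    have "Q (Var i ^ k)"
      using assms(1)[of 1] by (induction k) (auto intro: assms)
    then show ?case by (simp add: Var_power)
  next
    case (add d e)
    then show ?case using assms(4)[OF add] by (simp add: mult_single)
  qed
  moreover have "Poly_Mapping.single e c = Const c * Poly_Mapping.single e 1"
    by (simp add: Const_def mult_single)
  ultimately show ?case using assms by metis
next
  case (add p q)
  then show ?case by (rule assms)
qed

section \<open>Substitution of univariate polynomials\<close>

text \<open>Evaluation at a point whose coordinates are univariate polynomials. It serves to isolate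
  one variable (\<open>uni\<close>) and to take first-order expansions
  (\<open>derivation_of\<close>).\<close>

definition subst ::
  "('i \<Rightarrow> ('i, 'k) mpoly poly) \<Rightarrow> ('i::finite, 'k::comm_ring_1) mpoly \<Rightarrow> ('i, 'k) mpoly poly" where
  "subst y p = (\<Sum>e\<in>Poly_Mapping.keys p. [:Const (Poly_Mapping.lookup p e):] *
     (\<Prod>i\<in>UNIV. y i ^ Poly_Mapping.lookup e i))"

lemma subst_add: "subst y (p + q) = subst y p + subst y q"
  unfolding subst_def
  by (rule setsum_keys_plus_distrib) (simp_all add: Const_add smult_add_left)

lemma subst_single: "subst y (Poly_Mapping.single e c) =
    [:Const c:] * (\<Prod>i\<in>UNIV. y i ^ Poly_Mapping.lookup e i)"
  by (simp add: subst_def)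

lemma subst_0 [simp]: "subst y 0 = 0"
  by (simp add: subst_def)

lemma subst_Const [simp]: "subst y (Const c) = [:Const c:]"
  by (simp add: Const_def subst_single)

lemma subst_1 [simp]: "subst y 1 = 1"
  using subst_Const[of y 1] by simp

lemma subst_Var [simp]: "subst y (Var i) = y i"
proof -
  have "(\<Prod>j\<in>UNIV. y j ^ Poly_Mapping.lookup (Poly_Mapping.single i 1) j) =
      (\<Prod>j\<in>UNIV. if j = i then y j else 1)"
    by (intro prod.cong) (auto simp: lookup_single when_def)
  then show ?thesis by (simp add: Var_def subst_single)
qed

lemma subst_mult: "subst y (p * q) = subst y p * subst y q"
proof (induction p rule: mpoly_induct)
  case (single d b)
  then show ?case
  proof (induction q rule: mpoly_induct)
    case (single e c)
    then show ?case
      by (simp add: mult_single subst_single Const_mult lookup_add power_add prod.distrib mult_ac)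
  qed (simp_all add: algebra_simps subst_add)
qed (simp_all add: algebra_simps subst_add)

lemma subst_uminus: "subst y (- p) = - subst y p"
  using subst_add[of y p "- p"] by (simp add: add_eq_0_iff)

lemma subst_diff: "subst y (p - q) = subst y p - subst y q"
  using subst_add[of y p "- q"] by (simp add: subst_uminus)

lemma subst_power: "subst y (p ^ n) = subst y p ^ n"
  by (induction n) (simp_all add: subst_mult)

text \<open>Evaluating the outer variable at \<open>z\<close> is a ring homomorphism, so its
  composite with \<open>subst y\<close> is the identity once it fixes all variables.\<close>

lemma poly_subst_eq:
  assumes "\<And>i. poly (y i) z = Var i"
  shows "poly (subst y p) z = p"
  by (induction p rule: mpoly_var_induct) (simp_all add: subst_add subst_mult assms)

section \<open>Polynomials in a subset of the variables\<close>

text \<open>A subring kept as a subset of the full ring, so that induction on \<open>I\<close> never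
  changes the type.\<close>

definition polys_in :: "'i set \<Rightarrow> ('i, 'k::comm_ring_1) mpoly set" where
  "polys_in I = {p. \<forall>e\<in>Poly_Mapping.keys p. Poly_Mapping.keys e \<subseteq> I}"

lemma polys_in_UNIV [simp]: "polys_in UNIV = UNIV"
  by (simp add: polys_in_def)

lemma polys_in_mono: "I \<subseteq> J \<Longrightarrow> p \<in> polys_in I \<Longrightarrow> p \<in> polys_in J"
  by (auto simp: polys_in_def)

lemma polys_in_Int: "p \<in> polys_in I \<Longrightarrow> p \<in> polys_in J \<Longrightarrow> p \<in> polys_in (I \<inter> J)"
  by (auto simp: polys_in_def)

lemma polys_in_Const [simp]: "Const c \<in> polys_in I"
  by (simp add: polys_in_def Const_def)

lemma polys_in_0 [simp]: "0 \<in> polys_in I" and polys_in_1 [simp]: "1 \<in> polys_in I"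
  by (simp_all add: polys_in_def)

lemma polys_in_Var: "i \<in> I \<Longrightarrow> Var i \<in> polys_in I"
  by (auto simp: polys_in_def Var_def)

lemma polys_in_add: "p \<in> polys_in I \<Longrightarrow> q \<in> polys_in I \<Longrightarrow> p + q \<in> polys_in I"
  using Poly_Mapping.keys_add[of p q] by (auto simp: polys_in_def)

lemma polys_in_uminus: "p \<in> polys_in I \<Longrightarrow> - p \<in> polys_in I"
  by (auto simp: polys_in_def in_keys_iff)

lemma polys_in_diff: "p \<in> polys_in I \<Longrightarrow> q \<in> polys_in I \<Longrightarrow> p - q \<in> polys_in I"
  using polys_in_add[of p I "- q"] polys_in_uminus[of q I] by simp

lemma polys_in_mult:
  assumes "p \<in> polys_in I" "q \<in> polys_in I"
  shows "p * q \<in> polys_in I"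
  unfolding polys_in_def
proof safe
  fix e j assume "e \<in> Poly_Mapping.keys (p * q)" "j \<in> Poly_Mapping.keys e"
  then obtain a b where "e = a + b" "a \<in> Poly_Mapping.keys p" "b \<in> Poly_Mapping.keys q"
    using Poly_Mapping.keys_mult[of p q] by blast
  then show "j \<in> I"
    using assms \<open>j \<in> _\<close> Poly_Mapping.keys_add[of a b] unfolding polys_in_def by blast
qed

lemma polys_in_sum: "(\<And>i. i \<in> A \<Longrightarrow> f i \<in> polys_in I) \<Longrightarrow> sum f A \<in> polys_in I"
  by (induction A rule: infinite_finite_induct) (auto intro: polys_in_add)

lemma polys_in_prod: "(\<And>i. i \<in> A \<Longrightarrow> f i \<in> polys_in I) \<Longrightarrow> prod f A \<in> polys_in I"
  by (induction A rule: infinite_finite_induct) (auto intro: polys_in_mult)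

lemma polys_in_power: "p \<in> polys_in I \<Longrightarrow> p ^ n \<in> polys_in I"
  by (induction n) (auto intro: polys_in_mult)

text \<open>This views \<open>p\<close> as a polynomial in \<open>Var v\<close>. The coefficients
  have the type of the full ring; that they avoid \<open>v\<close> is shown in
  \<open>coeff_uni_in\<close>.\<close>

definition uni :: "'i \<Rightarrow> ('i::finite, 'k::comm_ring_1) mpoly \<Rightarrow> ('i, 'k) mpoly poly" where
  "uni v = subst (\<lambda>i. if i = v then [:0, 1:] else [:Var i:])"

lemmas uni_diff = subst_diff[of "\<lambda>i. if i = v then [:0, 1:] else [:Var i:]" for v, folded uni_def]
lemmas uni_mult = subst_mult[of "\<lambda>i. if i = v then [:0, 1:] else [:Var i:]" for v, folded uni_def]
lemmas uni_power = subst_power[of "\<lambda>i. if i = v then [:0, 1:] else [:Var i:]" for v, folded uni_def]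

lemma uni_0 [simp]: "uni v 0 = 0" and uni_1 [simp]: "uni v 1 = 1"
  by (simp_all add: uni_def)

lemma uni_Var_self [simp]: "uni v (Var v) = [:0, 1:]"
  by (simp add: uni_def)

lemma poly_uni [simp]: "poly (uni v p) (Var v) = p"
  unfolding uni_def by (rule poly_subst_eq) simp

lemma uni_eq_0_iff [simp]: "uni v p = 0 \<longleftrightarrow> p = 0"
  by (metis poly_0 poly_uni uni_0)

lemma coeff_uni_in:
  assumes p: "p \<in> polys_in (insert v I)"
  shows "coeff (uni v p) n \<in> polys_in I"
proof -
  \<comment> \<open>A subring containing the values substituted for all variables that occur in
    \<open>p\<close>; the other variables have exponent 0.\<close>
  define S :: "('a, 'b) mpoly poly set" where "S = {A. \<forall>n. coeff A n \<in> polys_in I}"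
  have S1: "1 \<in> S" "[:0, 1:] \<in> S" "\<And>a. a \<in> polys_in I \<Longrightarrow> [:a:] \<in> S"
    by (auto simp: S_def coeff_pCons split: nat.splits)
  have Sm: "A * B \<in> S" if "A \<in> S" "B \<in> S" for A B
    using that by (auto simp: S_def coeff_mult intro!: polys_in_sum polys_in_mult)
  have Sp: "A ^ n \<in> S" if "A \<in> S" for A n
    using that by (induction n) (auto intro: Sm S1)
  have Sprod: "prod f A \<in> S" if "\<And>i. i \<in> A \<Longrightarrow> f i \<in> S" for f and A :: "'a set"
    using that by (induction A rule: infinite_finite_induct) (auto intro: Sm S1)
  have Ssum: "sum f A \<in> S" if "\<And>i. i \<in> A \<Longrightarrow> f i \<in> S" for f and A :: "('a \<Rightarrow>\<^sub>0 nat) set"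
    using that by (induction A rule: infinite_finite_induct) (auto simp: S_def intro: polys_in_add)
  have "uni v p \<in> S"
    unfolding uni_def subst_def
  proof (intro Ssum Sm Sprod)
    fix e i assume "e \<in> Poly_Mapping.keys p"
    then have "Poly_Mapping.keys e \<subseteq> insert v I" using p by (auto simp: polys_in_def)
    then have "i \<in> insert v I \<or> Poly_Mapping.lookup e i = 0" by (meson in_keys_iff subsetD)
    then show "(if i = v then [:0, 1:] else [:Var i:]) ^ Poly_Mapping.lookup e i \<in> S"
      by (auto intro: Sp S1 polys_in_Var)
  qed (auto intro: S1)
  then show ?thesis by (auto simp: S_def)
qed

lemma uni_polys_in:
  assumes p: "p \<in> polys_in I" and v: "v \<notin> I"
  shows "uni v p = [:p:]"
proof -
  define S :: "('a, 'b) mpoly poly set" where "S = {A. degree A = 0}"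
  have S1: "1 \<in> S" and S0: "0 \<in> S" by (simp_all add: S_def)
  have Sm: "A * B \<in> S" if "A \<in> S" "B \<in> S" for A B
    using that by (auto simp: S_def elim!: degree_eq_zeroE)
  have Sprod: "prod f A \<in> S" if "\<And>i. i \<in> A \<Longrightarrow> f i \<in> S" for f and A :: "'a set"
    using that by (induction A rule: infinite_finite_induct) (auto intro: Sm S1)
  have Sa: "A + B \<in> S" if "A \<in> S" "B \<in> S" for A B
    using that by (auto simp: S_def elim!: degree_eq_zeroE)
  have Ssum: "sum f A \<in> S" if "\<And>i. i \<in> A \<Longrightarrow> f i \<in> S" for f and A :: "('a \<Rightarrow>\<^sub>0 nat) set"
    using that by (induction A rule: infinite_finite_induct) (auto intro: Sa S0)
  have "uni v p \<in> S"
    unfolding uni_def subst_def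
  proof (intro Ssum Sm Sprod)
    fix e i assume "e \<in> Poly_Mapping.keys p"
    then have "Poly_Mapping.keys e \<subseteq> I" using p by (auto simp: polys_in_def)
    then have "i \<noteq> v \<or> Poly_Mapping.lookup e i = 0" using v by (meson in_keys_iff subsetD)
    then show "(if i = v then [:0, 1:] else [:Var i:]) ^ Poly_Mapping.lookup e i \<in> S"
      by (auto simp: S_def poly_const_pow)
  qed (auto simp: S_def)
  then obtain a where "uni v p = [:a:]" by (auto simp: S_def elim: degree_eq_zeroE)
  then show ?thesis using poly_uni[of v p] by simp
qed

lemma degree_uni_eq_0_iff: "degree (uni v p) = 0 \<longleftrightarrow> p \<in> polys_in (- {v})"
proof
  assume "degree (uni v p) = 0"
  then obtain a where a: "uni v p = [:a:]" by (rule degree_eq_zeroE)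
  then have "p = coeff (uni v p) 0" using poly_uni[of v p] by simp
  then show "p \<in> polys_in (- {v})"
    using coeff_uni_in[of p v "- {v}" 0] by (simp add: Un_commute Compl_partition insert_is_Un[of v "- {v}"])
qed (simp add: uni_polys_in)

lemma polys_in_iff_degree: "p \<in> polys_in I \<longleftrightarrow> (\<forall>v. v \<notin> I \<longrightarrow> degree (uni v p) = 0)"
  unfolding degree_uni_eq_0_iff by (auto simp: polys_in_def)

text \<open>Over a domain the degrees in each variable add, so a variable missing from a nonzero
  product is missing from its factors. The linear order on the indices provides the domain property
  through an order on monomials.\<close>

lemma polys_in_factor:
  fixes p q :: "('i::{finite, linorder}, 'k::idom) mpoly"
  assumes "p * q \<in> polys_in I" "p * q \<noteq> 0"
  shows "p \<in> polys_in I"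
  using assms unfolding polys_in_iff_degree by (auto simp: uni_mult degree_mult_eq)

lemma polys_in_dvd:
  fixes p q :: "('i::{finite, linorder}, 'k::idom) mpoly"
  shows "p dvd q \<Longrightarrow> q \<in> polys_in I \<Longrightarrow> q \<noteq> 0 \<Longrightarrow> p \<in> polys_in I"
  by (auto elim: polys_in_factor)

lemma polys_in_empty_unit:
  fixes p :: "('i, 'k::field) mpoly"
  assumes "p \<in> polys_in {}" "p \<noteq> 0"
  shows "p dvd 1"
proof -
  have "Poly_Mapping.keys p \<subseteq> {0}"
    using assms by (auto simp: polys_in_def)
  then have "p = Const (Poly_Mapping.lookup p 0)"
    by (intro poly_mapping_eqI) (auto simp: Const_def lookup_single when_def in_keys_iff)
  then show ?thesis using assms(2) Const_dvd_1 by (metis Const_eq_0_iff)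
qed

lemma Var_nonzero [simp]: "Var i \<noteq> (0 :: ('i, 'k::comm_ring_1) mpoly)"
  by (simp add: Var_def poly_mapping_eq_iff fun_eq_iff lookup_single when_def exI[of _ "Poly_Mapping.single i 1"])

text \<open>The constant coefficient of \<open>uni v p\<close> is the residue of \<open>p\<close>
  modulo \<open>Var v\<close>. It is multiplicative with values in a domain, whence variables are
  prime.\<close>

lemma Var_dvd_iff:
  fixes p :: "('i::{finite, linorder}, 'k::idom) mpoly"
  shows "Var v dvd p \<longleftrightarrow> coeff (uni v p) 0 = 0"
proof
  assume "coeff (uni v p) 0 = 0"
  then obtain A where "uni v p = pCons 0 A" by (metis coeff_pCons_0 pCons_cases)
  then have "p = Var v * poly A (Var v)" by (metis add_0 poly_pCons poly_uni)
  then show "Var v dvd p" by simp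
qed (auto simp: uni_mult)

lemma prime_elem_Var:
  "prime_elem (Var v :: ('i::{finite, linorder}, 'k::field) mpoly)"
proof (rule prime_elemI)
  show "\<not> Var v dvd (1 :: ('i, 'k) mpoly)" by (simp add: Var_dvd_iff)
qed (simp_all add: Var_dvd_iff uni_mult coeff_mult)

lemma Var_dvd_Var_iff:
  "(Var i :: ('i::{finite, linorder}, 'k::field) mpoly) dvd Var j \<longleftrightarrow> i = j"
proof -
  have "uni i (Var j :: ('i, 'k) mpoly) = [:Var j:]" if "i \<noteq> j"
    using that by (intro uni_polys_in[of _ "{j}"] polys_in_Var) auto
  then show ?thesis by (cases "i = j") (simp_all add: Var_dvd_iff)
qed

section \<open>Factorization\<close>

text \<open>The sum of the degrees in the single variables, not the total degree: additivity is
  inherited from univariate polynomials, and a nonzero polynomial of value 0 is a constant.\<close>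

definition tdeg :: "('i::finite, 'k::comm_ring_1) mpoly \<Rightarrow> nat" where
  "tdeg p = (\<Sum>v\<in>UNIV. degree (uni v p))"

lemma tdeg_mult:
  fixes p q :: "('i::{finite, linorder}, 'k::idom) mpoly"
  shows "p \<noteq> 0 \<Longrightarrow> q \<noteq> 0 \<Longrightarrow> tdeg (p * q) = tdeg p + tdeg q"
  by (simp add: tdeg_def uni_mult degree_mult_eq sum.distrib)

lemma tdeg_0_unit:
  fixes p :: "('i::finite, 'k::field) mpoly"
  shows "tdeg p = 0 \<Longrightarrow> p \<noteq> 0 \<Longrightarrow> p dvd 1"
  by (rule polys_in_empty_unit) (simp_all add: polys_in_iff_degree tdeg_def)

lemma exists_irreducible_factor:
  fixes p :: "('i::{finite, linorder}, 'k::field) mpoly"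
  assumes "p \<noteq> 0" "\<not> p dvd 1"
  shows "\<exists>q. irreducible q \<and> q dvd p"
proof -
  \<comment> \<open>A non-unit divisor of least \<open>tdeg\<close> is irreducible, since a proper
    factor would have smaller \<open>tdeg\<close>.\<close>
  define Q where "Q q \<longleftrightarrow> q dvd p \<and> \<not> q dvd 1" for q
  have "Q p" using assms by (simp add: Q_def)
  then obtain q where q: "Q q" and min: "\<And>q'. Q q' \<Longrightarrow> tdeg q \<le> tdeg q'"
    using ex_has_least_nat[of Q p tdeg] by metis
  have q0: "q \<noteq> 0" using q assms by (metis Q_def dvd_0_left)
  have "irreducible q"
  proof (rule irreducibleI)
    fix a b assume ab: "q = a * b"
    show "a dvd 1 \<or> b dvd 1"
    proof (rule ccontr)
      assume *: "\<not> (a dvd 1 \<or> b dvd 1)"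
      then have "Q a" using q ab by (metis Q_def dvd_mult_left)
      then have "tdeg q \<le> tdeg a" using min by blast
      moreover have ab0: "a \<noteq> 0" "b \<noteq> 0" using ab q0 by auto
      moreover have "tdeg b > 0" using tdeg_0_unit[of b] * ab0 by auto
      moreover have "tdeg q = tdeg a + tdeg b" unfolding ab using ab0 by (rule tdeg_mult)
      ultimately show False by linarith
    qed
  next
    show "\<not> q dvd 1" using q by (simp add: Q_def)
  qed (rule q0)
  then show ?thesis using q unfolding Q_def by blast
qed

text \<open>Existence of factorizations into irreducibles, packaged as an induction; the descent is
  on \<open>tdeg\<close>.\<close>

lemma factor_induct [consumes 1, case_names unit irreducible]:
  fixes p :: "('i::{finite, linorder}, 'k::field) mpoly"
  assumes "p \<noteq> 0" and unit: "\<And>u. u dvd 1 \<Longrightarrow> Q u"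
    and irr: "\<And>q p. irreducible q \<Longrightarrow> p \<noteq> 0 \<Longrightarrow> Q p \<Longrightarrow> Q (q * p)"
  shows "Q p"
  using assms(1)
proof (induction "tdeg p" arbitrary: p rule: less_induct)
  case less
  show ?case
  proof (cases "p dvd 1")
    case False
    then obtain q p' where q: "irreducible q" "p = q * p'"
      using exists_irreducible_factor less.prems by (metis dvd_def)
    then have "q \<noteq> 0" "p' \<noteq> 0" using less.prems by auto
    moreover have "tdeg q > 0" using tdeg_0_unit q(1) by (metis irreducible_def not_gr0)
    ultimately show ?thesis using less.hyps[of p'] irr q by (simp add: tdeg_mult)
  qed (rule unit)
qed

lemma reductum:
  fixes p :: "('i::{finite, linorder}, 'k::idom) mpoly"
  assumes "p \<in> polys_in (insert v I)" "v \<notin> I" "p \<noteq> 0"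
  defines "l \<equiv> lead_coeff (uni v p)" and "d \<equiv> degree (uni v p)"
  shows "p - l * Var v ^ d = 0 \<or> degree (uni v (p - l * Var v ^ d)) < d"
proof -
  have "l \<in> polys_in I" unfolding l_def using assms(1) by (rule coeff_uni_in)
  then have *: "uni v (p - l * Var v ^ d) = uni v p - monom l d"
    using assms(2) by (simp add: uni_diff uni_mult uni_power uni_polys_in[of l I] monom_altdef)
  have "degree (uni v p - monom l d) \<le> d"
    by (rule degree_diff_le) (auto simp: d_def degree_monom_le)
  moreover have "coeff (uni v p - monom l d) d = 0"
    by (simp add: l_def d_def)
  ultimately have "uni v p - monom l d = 0 \<or> degree (uni v p - monom l d) < d"
    using eq_zero_or_degree_less by blast
  then show ?thesis unfolding * [symmetric] by simp
qed

text \<open>Division by \<open>q\<close> in the variable \<open>v\<close>. Instead of inverting the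
  leading coefficient of \<open>q\<close>, each round multiplies \<open>a\<close> by it, and
  \<open>s\<close> collects these multipliers.\<close>

lemma pseudo_division:
  fixes a q :: "('i::{finite, linorder}, 'k::idom) mpoly"
  assumes a: "a \<in> polys_in (insert v I)" and q: "q \<in> polys_in (insert v I)" "q \<noteq> 0"
    and v: "v \<notin> I"
  shows "\<exists>s t r. s \<in> polys_in I \<and> s \<noteq> 0 \<and> t \<in> polys_in (insert v I) \<and> r \<in> polys_in (insert v I) \<and>
    s * a = q * t + r \<and> (r = 0 \<or> degree (uni v r) < degree (uni v q))"
  using a
proof (induction "degree (uni v a)" arbitrary: a rule: less_induct)
  case less
  define la lq da dq where "la = lead_coeff (uni v a)" and "lq = lead_coeff (uni v q)"
    and "da = degree (uni v a)" and "dq = degree (uni v q)"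
  have la: "la \<in> polys_in I" and lq: "lq \<in> polys_in I" "lq \<noteq> 0"
    using less.prems q by (auto simp: la_def lq_def intro: coeff_uni_in)
  have mono: "p \<in> polys_in (insert v I)" if "p \<in> polys_in I" for p :: "('i, 'k) mpoly"
    using that by (rule polys_in_mono[rotated]) auto
  show ?case
  proof (cases "a = 0 \<or> da < dq")
    case True
    then show ?thesis
      using less.prems
      by (intro exI[of _ 1] exI[of _ 0] exI[of _ a]) (auto simp: da_def dq_def)
  next
    case False
    \<comment> \<open>With this \<open>u\<close> the leading terms of \<open>lq * a\<close> and
      \<open>u * q\<close> cancel.\<close>
    define u where "u = la * Var v ^ (da - dq)"
    define b where "b = lq * a - u * q"
    have u: "u \<in> polys_in (insert v I)"
      unfolding u_def by (intro polys_in_mult mono la polys_in_power polys_in_Var) simp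
    then have b: "b \<in> polys_in (insert v I)"
      unfolding b_def by (intro polys_in_diff polys_in_mult mono[OF lq(1)] less.prems q)
    have "uni v b = smult lq (uni v a) - monom la (da - dq) * uni v q"
      using v la lq by (simp add: b_def u_def uni_diff uni_mult uni_power uni_polys_in monom_altdef)
    moreover have "degree (smult lq (uni v a)) \<le> da"
      by (simp add: da_def)
    moreover have "degree (monom la (da - dq) * uni v q) \<le> da"
      by (rule order_trans[OF degree_mult_le])
        (use False in \<open>simp add: dq_def degree_monom_le[THEN order_trans] da_def degree_monom_eq la_def\<close>)
    moreover have "coeff (smult lq (uni v a)) da = coeff (monom la (da - dq) * uni v q) da"
      using False by (simp add: coeff_monom_mult la_def lq_def da_def dq_def)
    ultimately have "uni v b = 0 \<or> degree (uni v b) < da"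
      by (intro eq_zero_or_degree_less) (auto intro: degree_diff_le)
    then consider "b = 0" | "degree (uni v b) < da" by auto
    then show ?thesis
    proof cases
      case 1
      then have "lq * a = q * u + 0" by (simp add: b_def algebra_simps)
      then show ?thesis using u lq by (metis polys_in_0)
    next
      case 2
      then obtain s t r where str: "s \<in> polys_in I" "s \<noteq> 0" "t \<in> polys_in (insert v I)"
        "r \<in> polys_in (insert v I)" "s * b = q * t + r" "r = 0 \<or> degree (uni v r) < dq"
        using less.hyps[of b] b unfolding da_def dq_def by blast
      have "(s * lq) * a = s * b + q * (s * u)"
        by (simp add: b_def algebra_simps)
      then have "(s * lq) * a = q * (t + s * u) + r"
        unfolding str(5) by (simp only: algebra_simps)
      moreover have "s * lq \<in> polys_in I" "s * lq \<noteq> 0" "t + s * u \<in> polys_in (insert v I)"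
        using str lq u by (auto intro: polys_in_mult polys_in_add mono)
      ultimately show ?thesis using str unfolding dq_def by blast
    qed
  qed
qed

section \<open>Irreducible polynomials are prime\<close>

text \<open>Irreducibility refers to the full ring for every \<open>S\<close>. For
  \<open>S = polys_in I\<close> this agrees with irreducibility in the subring, because divisors of
  its nonzero elements stay in it (\<open>polys_in_dvd\<close>).\<close>

definition irreducibles_prime_in :: "('i::finite, 'k::comm_ring_1) mpoly set \<Rightarrow> bool" where
  "irreducibles_prime_in S \<longleftrightarrow> (\<forall>p a b. p \<in> S \<longrightarrow> a \<in> S \<longrightarrow> b \<in> S \<longrightarrow> irreducible p \<longrightarrow>
     p dvd a * b \<longrightarrow> p dvd a \<or> p dvd b)"

lemma irreducibles_prime_inD:
  "irreducibles_prime_in S \<Longrightarrow> irreducible p \<Longrightarrow> p dvd a * b \<Longrightarrow> p \<in> S \<Longrightarrow> a \<in> S \<Longrightarrow> b \<in> S \<Longrightarrow>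
    p dvd a \<or> p dvd b"
  unfolding irreducibles_prime_in_def by blast

text \<open>Gauss' lemma: a prime of the coefficient ring stays prime after adjoining
  \<open>v\<close>. It divides the product of the leading coefficients, hence one of them; removing
  that leading term lowers the sum of the degrees.\<close>

lemma gauss_const:
  fixes p a b :: "('i::{finite, linorder}, 'k::field) mpoly"
  assumes IH: "irreducibles_prime_in (polys_in I :: ('i, 'k) mpoly set)"
    and p: "irreducible p" "p \<in> polys_in I" and v: "v \<notin> I"
    and "a \<in> polys_in (insert v I)" "b \<in> polys_in (insert v I)" "p dvd a * b"
  shows "p dvd a \<or> p dvd b"
  using assms(5-7)
proof (induction "degree (uni v a) + degree (uni v b)" arbitrary: a b rule: less_induct)
  case less
  show ?case
  proof (cases "a = 0 \<or> b = 0")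
    case False
    have mono: "q \<in> polys_in (insert v I)" if "q \<in> polys_in I" for q :: "('i, 'k) mpoly"
      using that by (rule polys_in_mono[rotated]) auto
    have X: "Var v ^ n \<in> polys_in (insert v I)" for n
      by (intro polys_in_power polys_in_Var) simp
    define la lb where "la = lead_coeff (uni v a)" and "lb = lead_coeff (uni v b)"
    have l: "la \<in> polys_in I" "lb \<in> polys_in I"
      unfolding la_def lb_def using less.prems by (auto intro: coeff_uni_in)
    obtain c where "a * b = p * c" using less.prems(3) by blast
    then have "uni v a * uni v b = [:p:] * uni v c"
      using uni_polys_in[OF p(2) v] by (metis uni_mult)
    then have "la * lb = p * lead_coeff (uni v c)"
      unfolding la_def lb_def lead_coeff_mult[symmetric] by (simp add: lead_coeff_mult)
    then have "p dvd la * lb" by simp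
    then consider "p dvd la" | "p dvd lb"
      using irreducibles_prime_inD[OF IH p(1)] l p(2) by blast
    then show ?thesis
    proof cases
      case 1
      define a' where "a' = a - la * Var v ^ degree (uni v a)"
      have "a' * b = a * b - la * (Var v ^ degree (uni v a) * b)"
        by (simp add: a'_def algebra_simps)
      then have d: "p dvd a' * b" using 1 less.prems(3) by (simp add: dvd_diff dvd_mult2)
      have a': "a' \<in> polys_in (insert v I)"
        unfolding a'_def by (intro polys_in_diff polys_in_mult mono l X less.prems)
      have "a' = 0 \<or> degree (uni v a') < degree (uni v a)"
        using reductum[OF less.prems(1) v] False by (simp add: a'_def la_def)
      then have "p dvd a' \<or> p dvd b"
        using less.hyps[of a' b] d a' less.prems(2) by auto
      moreover have "a = a' + la * Var v ^ degree (uni v a)" by (simp add: a'_def)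
      ultimately show ?thesis using 1 by (metis dvd_add dvd_mult2)
    next
      case 2
      define b' where "b' = b - lb * Var v ^ degree (uni v b)"
      have "a * b' = a * b - lb * (Var v ^ degree (uni v b) * a)"
        by (simp add: b'_def algebra_simps)
      then have d: "p dvd a * b'" using 2 less.prems(3) by (simp add: dvd_diff dvd_mult2)
      have b': "b' \<in> polys_in (insert v I)"
        unfolding b'_def by (intro polys_in_diff polys_in_mult mono l X less.prems)
      have "b' = 0 \<or> degree (uni v b') < degree (uni v b)"
        using reductum[OF less.prems(2) v] False by (simp add: b'_def lb_def)
      then have "p dvd a \<or> p dvd b'"
        using less.hyps[of a b'] d b' less.prems(1) by auto
      moreover have "b = b' + lb * Var v ^ degree (uni v b)" by (simp add: b'_def)
      ultimately show ?thesis using 2 by (metis dvd_add dvd_mult2)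
    qed
  qed auto
qed

text \<open>An irreducible factor of \<open>d\<close> cannot divide \<open>p\<close>, since
  \<open>p\<close> is irreducible and involves \<open>v\<close>. By \<open>gauss_const\<close> it
  divides the cofactor of \<open>p\<close> and can be cancelled.\<close>

lemma cancel_const_factor:
  fixes p d a :: "('i::{finite, linorder}, 'k::field) mpoly"
  assumes IH: "irreducibles_prime_in (polys_in I :: ('i, 'k) mpoly set)"
    and v: "v \<notin> I" and d: "d \<noteq> 0" "d \<in> polys_in I"
    and p: "irreducible p" "p \<in> polys_in (insert v I)" "degree (uni v p) > 0"
    and a: "a \<in> polys_in (insert v I)" "p dvd d * a"
  shows "p dvd a"
  using d a
proof (induction d rule: factor_induct)
  case (unit u)
  then obtain w where "1 = u * w" by blast
  then have "a = w * (u * a)" by (simp add: algebra_simps flip: mult.assoc)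
  then show ?case using unit.prems by (metis dvd_mult)
next
  case (irreducible \<pi> d)
  have in1: "\<pi> \<in> polys_in I" "d \<in> polys_in I"
    by (rule polys_in_dvd[OF _ irreducible.prems(1)], use irreducible.hyps in \<open>simp; fail\<close>,
        use irreducible.hyps in force)+
  show ?case
  proof (cases "a = 0")
    case False
    obtain w where w: "\<pi> * d * a = p * w" using irreducible.prems(3) by blast
    have "p * w \<noteq> 0" using w False irreducible.hyps by auto
    have mono: "q \<in> polys_in (insert v I)" if "q \<in> polys_in I" for q :: "('i, 'k) mpoly"
      using that by (rule polys_in_mono[rotated]) auto
    have "\<pi> * d * a \<in> polys_in (insert v I)"
      by (intro polys_in_mult mono in1 irreducible.prems)
    then have "w \<in> polys_in (insert v I)"
      using \<open>p * w \<noteq> 0\<close> w by (metis dvd_triv_right polys_in_dvd)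
    moreover have "\<pi> dvd p * w" using w by (metis dvd_triv_left mult.assoc)
    ultimately have "\<pi> dvd p \<or> \<pi> dvd w"
      using gauss_const[OF IH irreducible.hyps(1) in1(1) v p(2)] by blast
    moreover have "\<not> \<pi> dvd p"
    proof
      assume "\<pi> dvd p"
      then obtain u where u: "p = \<pi> * u" by blast
      then have "u dvd 1"
        using p(1) irreducible.hyps(1) by (meson irreducible_def)
      then have "u \<in> polys_in {}" by (rule polys_in_dvd) auto
      then have "p \<in> polys_in I"
        unfolding u by (intro polys_in_mult in1 polys_in_mono[of "{}" I u]) auto
      then show False using p(3) uni_polys_in[of p I v] v by simp
    qed
    ultimately obtain w' where "w = \<pi> * w'" by blast
    then have "d * a = p * w'" using w irreducible.hyps(1) by auto
    then show ?thesis using irreducible.IH in1 irreducible.prems by simp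
  qed simp
qed

text \<open>Clearing a denominator \<open>d\<close> from a factorization of \<open>p\<close>: each
  irreducible factor of \<open>d\<close> divides \<open>a\<close> or \<open>t\<close> by
  \<open>gauss_const\<close>, and cancelling it there leaves the degree in \<open>v\<close>
  unchanged.\<close>

lemma split_const_factor:
  fixes p d a t :: "('i::{finite, linorder}, 'k::field) mpoly"
  assumes IH: "irreducibles_prime_in (polys_in I :: ('i, 'k) mpoly set)"
    and v: "v \<notin> I" and d: "d \<noteq> 0" "d \<in> polys_in I" and "p \<noteq> 0"
    and a: "a \<in> polys_in (insert v I)" "t \<in> polys_in (insert v I)" "d * p = a * t"
  shows "\<exists>a' t'. p = a' * t' \<and> degree (uni v a') = degree (uni v a) \<and>
    degree (uni v t') = degree (uni v t)"
  using d a
proof (induction d arbitrary: a t rule: factor_induct)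
  case (unit u)
  then obtain w where w: "u * w = 1" by (metis dvd_def)
  then have "w dvd 1" by (metis dvd_triv_right)
  then have "w \<in> polys_in {}" by (rule polys_in_dvd) auto
  then have "degree (uni v (w * a)) = degree (uni v a)"
    using w by (cases "w = 0") (simp_all add: uni_mult uni_polys_in[of w "{}"])
  moreover have "p = (w * a) * t"
  proof -
    have "p = (u * w) * p" by (simp add: w)
    then have "p = w * (u * p)" by (simp only: mult_ac)
    then show ?thesis by (simp add: unit.prems(4) mult.assoc)
  qed
  ultimately show ?case by (intro exI[of _ "w * a"] exI[of _ t]) simp
next
  case (irreducible \<pi> d)
  have in1: "\<pi> \<in> polys_in I" "d \<in> polys_in I"
    by (rule polys_in_dvd[OF _ irreducible.prems(1)], use irreducible.hyps in \<open>simp; fail\<close>,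
        use irreducible.hyps in force)+
  have pi0: "\<pi> \<noteq> 0" using irreducible.hyps by auto
  have pieq: "degree (uni v (\<pi> * b)) = degree (uni v b)" for b
    using pi0 v in1 by (simp add: uni_mult uni_polys_in[of \<pi> I])
  have at0: "a * t \<noteq> 0"
    using irreducible.hyps(2) pi0 \<open>p \<noteq> 0\<close> by (simp flip: irreducible.prems(4))
  have "\<pi> dvd a * t" by (simp flip: irreducible.prems(4) add: mult.assoc)
  then consider "\<pi> dvd a" | "\<pi> dvd t"
    using gauss_const[OF IH irreducible.hyps(1) in1(1) v] irreducible.prems by blast
  then show ?case
  proof cases
    case 1
    then obtain a' where a': "a = \<pi> * a'" by blast
    then have "a' \<in> polys_in (insert v I)"
      using irreducible.prems at0 by (intro polys_in_dvd[of a' a]) auto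
    moreover have "d * p = a' * t" using irreducible.prems(4) a' pi0 by (auto simp: mult.assoc)
    ultimately show ?thesis using irreducible.IH in1 irreducible.prems a' pieq by metis
  next
    case 2
    then obtain t' where t': "t = \<pi> * t'" by blast
    then have "t' \<in> polys_in (insert v I)"
      using irreducible.prems at0 by (intro polys_in_dvd[of t' t]) auto
    moreover have "d * p = a * t'"
      using irreducible.prems(4) t' pi0 by (auto simp: mult.assoc mult.left_commute)
    ultimately show ?thesis using irreducible.IH in1 irreducible.prems t' pieq by metis
  qed
qed

text \<open>If \<open>p\<close> is free of \<open>v\<close>, this is \<open>gauss_const\<close>.
  Otherwise \<open>a\<close> is pseudo-divided by \<open>p\<close>: either the remainder is 0 and
  the multiplier cancels, or it is a nonzero \<open>r\<close> of smaller degree with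
  \<open>p\<close> dividing \<open>r * b\<close>, and \<open>small\<close> applies.\<close>

lemma irreducibles_prime_step:
  assumes IH: "irreducibles_prime_in (polys_in I :: ('i::{finite, linorder}, 'k::field) mpoly set)"
    and v: "v \<notin> I"
  shows "irreducibles_prime_in (polys_in (insert v I) :: ('i, 'k) mpoly set)"
  unfolding irreducibles_prime_in_def
proof (intro allI impI)
  fix p a b :: "('i, 'k) mpoly"
  assume p: "p \<in> polys_in (insert v I)" and a: "a \<in> polys_in (insert v I)"
    and b: "b \<in> polys_in (insert v I)" and irr: "irreducible p" and dvd: "p dvd a * b"
  show "p dvd a \<or> p dvd b"
  proof (cases "degree (uni v p) = 0")
    case True
    then have "p \<in> polys_in I"
      using p unfolding polys_in_iff_degree by (metis insert_iff)
    then show ?thesis using gauss_const[OF IH irr _ v a b dvd] by blast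
  next
    case False
    then have deg: "degree (uni v p) > 0" by simp
    have p0: "p \<noteq> 0" using irr by auto
    \<comment> \<open>Euclidean descent on the degree of \<open>a\<close>: pseudo-dividing
      \<open>p\<close> by \<open>a\<close> leaves a remainder whose product with \<open>b\<close> is
      again divisible by \<open>p\<close>. It ends with an \<open>a\<close> free of
      \<open>v\<close>, which cancels.\<close>
    have small: "p dvd b" if "a \<noteq> 0" "degree (uni v a) < degree (uni v p)"
      "a \<in> polys_in (insert v I)" "p dvd a * b" for a
      using that
    proof (induction "degree (uni v a)" arbitrary: a rule: less_induct)
      case less
      show ?case
      proof (cases "degree (uni v a) = 0")
        case True
        then have "a \<in> polys_in I"
          using less.prems unfolding polys_in_iff_degree by (metis insert_iff)
        then show ?thesis using cancel_const_factor[OF IH v _ _ irr p deg b] less.prems by blast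
      next
        case False
        obtain s t r where str: "s \<in> polys_in I" "s \<noteq> 0" "t \<in> polys_in (insert v I)"
          "r \<in> polys_in (insert v I)" "s * p = a * t + r" "r = 0 \<or> degree (uni v r) < degree (uni v a)"
          using pseudo_division[OF p less.prems(3,1) v] by blast
        \<comment> \<open>A zero remainder would give a factorization of \<open>p\<close> with the
          degrees of \<open>a\<close> and \<open>t\<close>. One factor is a unit, of degree 0 in
          \<open>v\<close>, so the degree of \<open>a\<close> would be 0 or that of
          \<open>p\<close>.\<close>
        have "r \<noteq> 0"
        proof
          assume "r = 0"
          then obtain a' t' where at: "p = a' * t'" "degree (uni v a') = degree (uni v a)"
            "degree (uni v t') = degree (uni v t)"
            using split_const_factor[OF IH v str(2,1) p0 less.prems(3) str(3)] str(5) by auto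
          have "a' \<noteq> 0" "t' \<noteq> 0" using at p0 by auto
          then have "degree (uni v p) = degree (uni v a') + degree (uni v t')"
            using at by (simp add: uni_mult degree_mult_eq)
          moreover have "a' dvd 1 \<or> t' dvd 1" using irr at(1) by (meson irreducible_def)
          then have "a' \<in> polys_in {} \<or> t' \<in> polys_in {}"
            using polys_in_dvd polys_in_1 one_neq_zero by blast
          then have "degree (uni v a') = 0 \<or> degree (uni v t') = 0"
            using uni_polys_in[of _ "{}" v] by force
          ultimately show False using at less.prems(2) False by linarith
        qed
        moreover have "r * b = p * (s * b) - t * (a * b)"
        proof -
          have r: "r = s * p - a * t" using str(5) by simp
          show ?thesis unfolding r by (simp add: algebra_simps)
        qed
        then have "p dvd r * b" using less.prems(4) by (simp add: dvd_diff)
        ultimately show ?thesis using less.hyps[of r] str less.prems by auto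
      qed
    qed
    obtain s t r where str: "s \<in> polys_in I" "s \<noteq> 0" "t \<in> polys_in (insert v I)"
      "r \<in> polys_in (insert v I)" "s * a = p * t + r" "r = 0 \<or> degree (uni v r) < degree (uni v p)"
      using pseudo_division[OF a p p0 v] by blast
    show ?thesis
    proof (cases "r = 0")
      case True
      then have "p dvd s * a" using str(5) by simp
      then show ?thesis using cancel_const_factor[OF IH v str(2,1) irr p deg a] by blast
    next
      case False
      have r: "r = s * a - p * t" using str(5) by simp
      have "r * b = s * (a * b) - p * (t * b)" unfolding r by (simp add: algebra_simps)
      then have "p dvd r * b" using dvd by (simp add: dvd_diff)
      then show ?thesis using small[of r] str False by blast
    qed
  qed
qed

text \<open>The induction starts at \<open>polys_in {}\<close>, whose elements are 0 or units, and
  reaches the full ring at \<open>UNIV\<close>.\<close>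

theorem irreducible_imp_prime_elem:
  fixes p :: "('i::{finite, linorder}, 'k::field) mpoly"
  assumes "irreducible p"
  shows "prime_elem p"
proof -
  have "irreducibles_prime_in (polys_in I :: ('i, 'k) mpoly set)" for I :: "'i set"
  proof (induction I rule: finite_induct[OF finite])
    case 1
    show ?case
      unfolding irreducibles_prime_in_def irreducible_def using polys_in_empty_unit by blast
  next
    case (2 v I)
    then show ?case by (intro irreducibles_prime_step)
  qed
  from this[of UNIV] show ?thesis
    using assms unfolding irreducibles_prime_in_def
    by (intro prime_elemI) (auto simp: irreducible_def)
qed

section \<open>Coprimality\<close>

text \<open>The condition says that \<open>q\<close> is a non-zero-divisor modulo \<open>p\<close>. Unlike the absence of common
  divisors, it gives the cancellation property without appeal to unique factorization.\<close>

definition coprime_to :: "'a::comm_semiring_1 \<Rightarrow> 'a \<Rightarrow> bool" where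
  "coprime_to p q \<longleftrightarrow> (\<forall>z. p dvd q * z \<longrightarrow> p dvd z)"

lemma coprime_toD: "coprime_to p q \<Longrightarrow> p dvd q * z \<Longrightarrow> p dvd z"
  unfolding coprime_to_def by blast

text \<open>Symmetry needs \<open>p\<close> nonzero: \<open>coprime_to 0 q\<close> holds for every
  nonzero \<open>q\<close>, whereas \<open>coprime_to q 0\<close> forces \<open>q\<close> to be a
  unit.\<close>

lemma coprime_to_sym:
  assumes "coprime_to p q" "p \<noteq> (0 :: 'a::idom)"
  shows "coprime_to q p"
  unfolding coprime_to_def
proof (intro allI impI)
  fix z assume "q dvd p * z"
  then obtain w where w: "p * z = q * w" by blast
  then have "p dvd q * w" by (metis dvd_triv_left)
  then have "p dvd w" by (rule coprime_toD[OF assms(1)])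
  then obtain w' where "w = p * w'" by blast
  then have "p * z = p * (q * w')" using w by (simp only: mult_ac)
  then show "q dvd z" using assms(2) by simp
qed

lemma coprime_to_mult: "coprime_to p a \<Longrightarrow> coprime_to p b \<Longrightarrow> coprime_to p (a * b)"
  unfolding coprime_to_def mult.assoc by blast

lemma coprime_to_1: "coprime_to p 1"
  by (simp add: coprime_to_def)

lemma coprime_to_prod: "(\<And>i. i \<in> A \<Longrightarrow> coprime_to p (f i)) \<Longrightarrow> coprime_to p (prod f A)"
  by (induction A rule: infinite_finite_induct) (auto intro: coprime_to_mult coprime_to_1)

lemma coprime_to_power: "coprime_to p a \<Longrightarrow> coprime_to p (a ^ n)"
  by (induction n) (auto intro: coprime_to_mult coprime_to_1)

lemma coprime_to_dvd:
  assumes "coprime_to p a" "b dvd a"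
  shows "coprime_to p b"
  unfolding coprime_to_def
proof (intro allI impI)
  fix z assume z: "p dvd b * z"
  obtain c where "a = b * c" using assms(2) by blast
  then have "a * z = (b * z) * c" by (simp only: mult_ac)
  then have "p dvd a * z" using z by (metis dvd_mult2)
  then show "p dvd z" by (rule coprime_toD[OF assms(1)])
qed

text \<open>Modulo \<open>p\<close> the combination is a unit times \<open>q\<close>. This is the
  form in which members of the pencil are compared with each other and with \<open>f1\<close> and
  \<open>f2\<close>.\<close>

lemma coprime_to_linear:
  fixes p q :: "'a::comm_ring_1"
  assumes "coprime_to p q" "c dvd 1"
  shows "coprime_to p (c * q + t * p)"
  unfolding coprime_to_def
proof (intro allI impI)
  fix z assume z: "p dvd (c * q + t * p) * z"
  obtain d where d: "c * d = 1" using assms(2) by (metis dvd_def)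
  have "q * z = (c * d) * (q * z)" by (simp add: d)
  also have "\<dots> = d * ((c * q + t * p) * z) - p * (d * t * z)"
    by (simp add: algebra_simps)
  finally have eq: "q * z = d * ((c * q + t * p) * z) - p * (d * t * z)" .
  have "p dvd d * ((c * q + t * p) * z)" using z by (rule dvd_mult)
  then have "p dvd q * z" unfolding eq by (rule dvd_diff) (rule dvd_triv_left)
  then show "p dvd z" by (rule coprime_toD[OF assms(1)])
qed

lemma prime_elem_coprime_to: "prime_elem p \<Longrightarrow> \<not> p dvd q \<Longrightarrow> coprime_to p q"
  unfolding coprime_to_def using prime_elem_dvd_mult_iff by blast

text \<open>For \<open>p = r * u\<close> and \<open>q = r * w\<close> one has
  \<open>q * u = p * w\<close>, so \<open>p\<close> divides its own factor \<open>u\<close>, which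
  makes \<open>r\<close> a unit.\<close>

lemma coprime_to_unit:
  fixes p q r :: "'a::idom"
  assumes "coprime_to p q" "p \<noteq> 0" "r dvd p" "r dvd q"
  shows "r dvd 1"
proof -
  obtain u w where u: "p = r * u" and w: "q = r * w" using assms(3,4) by blast
  have "q * u = p * w" unfolding u w by (simp only: mult_ac)
  then have "p dvd q * u" by simp
  then have "p dvd u" by (rule coprime_toD[OF assms(1)])
  then obtain s where s: "u = p * s" by blast
  then have "u * (r * s) = u * 1" unfolding u by (simp add: mult_ac)
  moreover have "u \<noteq> 0" using u assms(2) by auto
  ultimately have "r * s = 1" by (metis mult_left_cancel)
  then show ?thesis by (metis dvd_triv_left)
qed

text \<open>The irreducible factors of \<open>p\<close> are prime and do not divide
  \<open>q\<close>, so they can be stripped off \<open>p\<close> and \<open>z\<close> one at a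
  time.\<close>

lemma coprime_toI_irreducible:
  fixes p q :: "('i::{finite, linorder}, 'k::field) mpoly"
  assumes "p \<noteq> 0" "\<And>r. irreducible r \<Longrightarrow> r dvd p \<Longrightarrow> \<not> r dvd q"
  shows "coprime_to p q"
  using assms
proof (induction p rule: factor_induct)
  case (unit u)
  then show ?case by (meson coprime_to_def dvd_trans one_dvd)
next
  case (irreducible r p)
  show ?case
    unfolding coprime_to_def
  proof (intro allI impI)
    fix z assume z: "r * p dvd q * z"
    then have "r dvd q * z" by (rule dvd_mult_left)
    then have "r dvd z"
      using irreducible irreducible_imp_prime_elem prime_elem_dvd_mult_iff by (metis dvd_triv_left)
    then obtain z' where z': "z = r * z'" by blast
    have "r * p dvd r * (q * z')" using z unfolding z' by (simp only: mult_ac)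
    then have "p dvd q * z'" using irreducible.hyps(1) by auto
    moreover have "coprime_to p q" using irreducible by (metis dvd_mult)
    ultimately have "p dvd z'" using coprime_toD by blast
    then show "r * p dvd z" unfolding z' by (rule mult_dvd_mono[OF dvd_refl])
  qed
qed

lemma coprime_to_mult_left:
  fixes p q z :: "'a::idom"
  assumes "coprime_to p z" "coprime_to q z" "p \<noteq> 0"
  shows "coprime_to (p * q) z"
  unfolding coprime_to_def
proof (intro allI impI)
  fix w assume *: "p * q dvd z * w"
  then have "p dvd z * w" by (rule dvd_mult_left)
  then have "p dvd w" by (rule coprime_toD[OF assms(1)])
  then obtain w' where w': "w = p * w'" by blast
  have "p * q dvd p * (z * w')" using * unfolding w' by (simp only: mult_ac)
  then have "q dvd z * w'" using assms(3) by simp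
  then have "q dvd w'" by (rule coprime_toD[OF assms(2)])
  then show "p * q dvd w" unfolding w' by (rule mult_dvd_mono[OF dvd_refl])
qed

lemma coprime_to_unit_left:
  "u dvd 1 \<Longrightarrow> coprime_to u z"
  unfolding coprime_to_def by (meson dvd_trans one_dvd)

lemma coprime_to_power_left:
  fixes p z :: "'a::idom"
  assumes "coprime_to p z" "p \<noteq> 0"
  shows "coprime_to (p ^ n) z"
  by (induction n) (use assms in \<open>auto intro: coprime_to_mult_left coprime_to_unit_left\<close>)

lemma coprime_to_prod_left:
  fixes f :: "'b \<Rightarrow> 'a::idom"
  assumes "\<And>i. i \<in> A \<Longrightarrow> coprime_to (f i) z" "\<And>i. i \<in> A \<Longrightarrow> f i \<noteq> 0"
  shows "coprime_to (prod f A) z"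
  using assms
  by (induction A rule: infinite_finite_induct) (auto intro: coprime_to_mult_left coprime_to_unit_left)

lemma prod_dvd_iff_coprime_to:
  fixes f :: "'b \<Rightarrow> 'a::idom"
  assumes "finite A" "\<And>i. i \<in> A \<Longrightarrow> f i \<noteq> 0"
    "\<And>i j. i \<in> A \<Longrightarrow> j \<in> A \<Longrightarrow> i \<noteq> j \<Longrightarrow> coprime_to (f i) (f j)"
  shows "prod f A dvd z \<longleftrightarrow> (\<forall>i\<in>A. f i dvd z)"
  using assms
proof (induction A arbitrary: z rule: finite_induct)
  case (insert i A)
  have c: "coprime_to (prod f A) (f i)"
    by (rule coprime_to_prod_left) (use insert.prems insert.hyps in \<open>metis insertI1 insertI2\<close>)+
  have IH: "prod f A dvd z \<longleftrightarrow> (\<forall>i\<in>A. f i dvd z)" for z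
    by (rule insert.IH) (use insert.prems in auto)
  show ?case
  proof
    assume "prod f (insert i A) dvd z"
    then have "f i * prod f A dvd z" using insert.hyps by simp
    then have "f i dvd z" "prod f A dvd z" by (rule dvd_mult_left, rule dvd_mult_right)
    then show "\<forall>j\<in>insert i A. f j dvd z" using IH by blast
  next
    assume *: "\<forall>j\<in>insert i A. f j dvd z"
    then obtain w where w: "z = f i * w" by blast
    have "prod f A dvd f i * w" using * IH[of z] unfolding w by blast
    then have "prod f A dvd w" by (rule coprime_toD[OF c])
    then have "f i * prod f A dvd z" unfolding w by (rule mult_dvd_mono[OF dvd_refl])
    then show "prod f (insert i A) dvd z" using insert.hyps by simp
  qed
qed simp

lemma coprime_Var_Var:
  "i \<noteq> j \<Longrightarrow> coprime_to (Var i) (Var j :: ('i::{finite, linorder}, 'k::field) mpoly)"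
  by (intro prime_elem_coprime_to prime_elem_Var) (simp add: Var_dvd_Var_iff)

section \<open>Squarefree products of coprime factors\<close>

lemma squarefree_1: "squarefree (1 :: 'a::comm_semiring_1)"
  unfolding squarefree_def power2_eq_square using dvd_mult_left by blast

lemma squarefree_mult_coprime_to:
  fixes p q :: "('i::{finite, linorder}, 'k::field) mpoly"
  assumes sf: "squarefree p" "squarefree q" and c: "coprime_to p q" and p0: "p \<noteq> 0"
    and q0: "q \<noteq> 0"
  shows "squarefree (p * q)"
  unfolding squarefree_def
proof (intro allI impI, rule ccontr)
  fix t assume t: "t ^ 2 dvd p * q" "\<not> t dvd 1"
  have "t \<noteq> 0" using t(1) p0 q0 by auto
  then obtain r where r: "irreducible r" "r dvd t" using exists_irreducible_factor t(2) by blast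
  have pr: "prime_elem r" using r(1) by (rule irreducible_imp_prime_elem)
  have r2: "r * r dvd p * q"
    using mult_dvd_mono[OF r(2) r(2)] t(1) by (metis dvd_trans power2_eq_square)
  have nu: "\<not> r dvd 1" using r(1) by (simp add: irreducible_def)
  \<comment> \<open>A prime \<open>r\<close> not dividing \<open>b\<close> moves both of its
    occurrences into \<open>a\<close>, contradicting squarefreeness of \<open>a\<close>. By
    coprimality one of \<open>p\<close> and \<open>q\<close> can take the role of
    \<open>b\<close>.\<close>
  have key: False if a: "squarefree a" and rr: "r * r dvd a * b" and nb: "\<not> r dvd b" for a b
  proof -
    have "r dvd a * b" using rr by (rule dvd_mult_left)
    then have "r dvd a" using pr nb prime_elem_dvd_mult_iff by blast
    then obtain a' where a': "a = r * a'" by blast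
    have "r * r dvd r * (a' * b)" using rr unfolding a' by (simp only: mult_ac)
    then have "r dvd a' * b" using r(1) by auto
    then have "r dvd a'" using pr nb prime_elem_dvd_mult_iff by blast
    then have "r * r dvd a" unfolding a' by (rule mult_dvd_mono[OF dvd_refl])
    then show False using a nu by (simp add: squarefree_def power2_eq_square)
  qed
  show False
  proof (cases "r dvd q")
    case True
    then have "\<not> r dvd p" using coprime_to_unit[OF c p0] nu by blast
    then show False using key[of q p] sf r2 by (simp add: mult.commute)
  next
    case False
    then show False using key[of p q] sf r2 by blast
  qed
qed

lemma squarefree_prod_coprime_to:
  fixes f :: "'a \<Rightarrow> ('i::{finite, linorder}, 'k::field) mpoly"
  assumes "\<And>i. i \<in> A \<Longrightarrow> squarefree (f i)" "\<And>i. i \<in> A \<Longrightarrow> f i \<noteq> 0"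
    "\<And>i j. i \<in> A \<Longrightarrow> j \<in> A \<Longrightarrow> i \<noteq> j \<Longrightarrow> coprime_to (f i) (f j)"
  shows "squarefree (prod f A)"
  using assms
proof (induction A rule: infinite_finite_induct)
  case (insert i A)
  have "coprime_to (f i) (prod f A)"
    by (rule coprime_to_prod) (use insert in auto)
  moreover have "prod f A \<noteq> 0" using insert by auto
  ultimately show ?case using insert by (simp add: squarefree_mult_coprime_to)
qed (simp_all add: squarefree_1)

lemma prime_elem_irreducible:
  fixes p :: "'a::idom"
  assumes "prime_elem p"
  shows "irreducible p"
proof (rule irreducibleI)
  have unit: "v dvd 1" if "p = u * v" and "p dvd u" for u v
  proof -
    obtain w where "u = p * w" using \<open>p dvd u\<close> by blast
    then have "p * (w * v) = p * 1" using \<open>p = u * v\<close> by (metis mult.assoc mult.right_neutral)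
    then have "w * v = 1" using assms by (metis mult_left_cancel prime_elem_def)
    then show ?thesis by (metis dvd_triv_right)
  qed
  fix u v assume uv: "p = u * v"
  then have "p dvd u \<or> p dvd v" using prime_elem_dvd_mult_iff[OF assms, of u v] by simp
  then show "u dvd 1 \<or> v dvd 1"
    using unit[OF uv] unit[of v u] uv by (metis mult.commute)
qed (use assms in \<open>auto simp: prime_elem_def\<close>)

lemma squarefree_irreducible:
  assumes "irreducible p"
  shows "squarefree p"
  unfolding squarefree_def
proof (intro allI impI)
  fix x assume "x ^ 2 dvd p"
  then obtain t where "p = x * (x * t)" by (metis dvd_def mult.assoc power2_eq_square)
  then have "x dvd 1 \<or> x * t dvd 1" using assms by (meson irreducible_def)
  then show "x dvd 1" by (auto dest: dvd_mult_left)
qed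

section \<open>Reduced polynomials\<close>

lemma prime_elem_dvd_prod:
  assumes "prime_elem p" "p dvd prod f A"
  shows "\<exists>i\<in>A. p dvd f i"
  using assms(2)
proof (induction A rule: infinite_finite_induct)
  case (insert i A)
  then show ?case using prime_elem_dvd_mult_iff[OF assms(1)] by auto
qed (use prime_elem_not_unit[OF assms(1)] in auto)

text \<open>The equality is exact, not up to a unit, as \<open>is_red\<close> demands. Units are
  therefore excluded here, the empty product being 1.\<close>

lemma squarefree_eq_prod_irreducibles:
  fixes p :: "('i::{finite, linorder}, 'k::field) mpoly"
  assumes "p \<noteq> 0" "squarefree p" "\<not> p dvd 1"
  shows "\<exists>S. finite S \<and> (\<forall>q\<in>S. irreducible q) \<and> p = \<Prod>S"
  using assms
proof (induction p rule: factor_induct)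
  case (irreducible q p)
  show ?case
  proof (cases "p dvd 1")
    \<comment> \<open>The unit cofactor is absorbed into the irreducible factor, so that the product
      consists of a single element.\<close>
    case True
    have "irreducible (q * p)"
    proof (rule irreducibleI)
      fix a b assume ab: "q * p = a * b"
      obtain w where w: "p * w = 1" using True by (metis dvd_def)
      have "q = q * (p * w)" by (simp add: w)
      also have "\<dots> = a * (b * w)" by (simp add: ab flip: mult.assoc)
      finally have "a dvd 1 \<or> b * w dvd 1"
        using irreducible.hyps(1) by (meson irreducible_def)
      then show "a dvd 1 \<or> b dvd 1" by (auto dest: dvd_mult_left)
    next
      show "\<not> q * p dvd 1"
        using irreducible.hyps(1) by (auto simp: irreducible_def dest: dvd_mult_left)
    qed (use irreducible.hyps in auto)
    moreover have "q * p = \<Prod>{q * p}" by simp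
    ultimately show ?thesis by blast
  next
    case False
    have "squarefree p" using irreducible.prems(1) unfolding squarefree_def by (metis dvd_mult)
    then obtain S where S: "finite S" "\<forall>q\<in>S. irreducible q" "p = \<Prod>S"
      using irreducible.IH False by blast
    have "q \<notin> S"
    proof
      assume "q \<in> S"
      then have "q dvd p" using dvd_prodI[OF S(1), of q "\<lambda>x. x"] S(3) by simp
      then have "q ^ 2 dvd q * p" by (simp add: power2_eq_square mult_dvd_mono)
      then have "q dvd 1" using irreducible.prems(1) unfolding squarefree_def by blast
      then show False using irreducible.hyps(1) by (simp add: irreducible_def)
    qed
    then have "q * p = \<Prod>(insert q S)" unfolding S(3) using S(1) by simp
    moreover have "\<forall>q\<in>insert q S. irreducible q" using S(2) irreducible.hyps(1) by blast
    ultimately show ?thesis using S(1) by blast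
  qed
qed blast

lemma irreducible_dvd_irreducible:
  fixes p q :: "'a::idom"
  assumes "irreducible p" "irreducible q" "p dvd q"
  shows "q dvd p"
proof -
  obtain u where u: "q = p * u" using assms(3) by blast
  then have "u dvd 1" using assms(1,2) by (meson irreducible_def)
  then obtain w where w: "u * w = 1" by (metis dvd_def)
  have "q * w = p * (u * w)" by (simp add: u mult.assoc)
  then have "p = q * w" by (simp add: w)
  then show ?thesis by simp
qed

lemma is_redI:
  fixes f g :: "('i::{finite, linorder}, 'k::field) mpoly"
  assumes g: "g \<noteq> 0" "squarefree g" "\<not> g dvd 1" "g dvd f"
    and irr: "\<And>q. irreducible q \<Longrightarrow> q dvd f \<Longrightarrow> q dvd g"
  shows "is_red f g"
proof -
  obtain S where S: "finite S" "\<forall>q\<in>S. irreducible q" "g = \<Prod>S"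
    using squarefree_eq_prod_irreducibles[OF g(1-3)] by blast
  have "\<exists>!p. p \<in> S \<and> p dvd q \<and> q dvd p" if q: "irreducible q" "q dvd f" for q
  proof -
    have "q dvd \<Prod>S" using irr[OF q] S(3) by simp
    then obtain p where p: "p \<in> S" "q dvd p"
      using prime_elem_dvd_prod[OF irreducible_imp_prime_elem[OF q(1)]] by blast
    show ?thesis
    proof (rule ex1I[of _ p])
      show "p \<in> S \<and> p dvd q \<and> q dvd p"
        using p irreducible_dvd_irreducible[OF q(1) _ p(2)] S(2) by blast
    next
      fix p' assume p': "p' \<in> S \<and> p' dvd q \<and> q dvd p'"
      \<comment> \<open>Two different members of \<open>S\<close> that are both divisible by
        \<open>q\<close> would give \<open>q ^ 2 dvd g\<close>.\<close>
      show "p' = p"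
      proof (rule ccontr)
        assume ne: "p' \<noteq> p"
        have "\<Prod>S = p * (p' * \<Prod>(S - {p} - {p'}))"
          using prod.remove[of S p "\<lambda>x. x"] prod.remove[of "S - {p}" p' "\<lambda>x. x"] S(1) p(1) p' ne
          by simp
        then have "p * p' dvd \<Prod>S" by (metis dvd_triv_left mult.assoc)
        then have "q ^ 2 dvd g"
          using mult_dvd_mono[OF p(2), of q p'] p' S(3) by (metis dvd_trans power2_eq_square)
        then have "q dvd 1" using g(2) by (simp add: squarefree_def)
        then show False using q(1) by (simp add: irreducible_def)
      qed
    qed
  qed
  moreover have "p dvd f" if "p \<in> S" for p
    using dvd_prodI[OF S(1) that, of "\<lambda>x. x"] g(4) S(3) dvd_trans by metis
  ultimately have "\<forall>q. irreducible q \<and> q dvd f \<longrightarrow> (\<exists>!p. p \<in> S \<and> p dvd q \<and> q dvd p)"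
    "\<forall>p\<in>S. irreducible p \<and> p dvd f"
    using S(2) by simp_all
  with S(1,3) show ?thesis
    unfolding is_red_def by (intro exI[of _ S] conjI)
qed

section \<open>Derivations\<close>

lemma derivationD:
  assumes "derivation \<delta>"
  shows derivation_add: "\<delta> (p + q) = \<delta> p + \<delta> q"
    and derivation_Const_mult: "\<delta> (Const c * p) = Const c * \<delta> p"
    and derivation_mult: "\<delta> (p * q) = p * \<delta> q + q * \<delta> p"
  using assms unfolding derivation_def by blast+

lemma derivation_0:
  assumes "derivation \<delta>"
  shows "\<delta> 0 = 0"
  using derivation_add[OF assms, of 0 0] by simp

lemma derivation_1:
  assumes "derivation \<delta>"
  shows "\<delta> 1 = 0"
  using derivation_mult[OF assms, of 1 1] by simp

lemma derivation_Const:
  assumes "derivation \<delta>"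
  shows "\<delta> (Const c) = 0"
  using derivation_Const_mult[OF assms, of c 1] derivation_1[OF assms] by simp

lemma derivation_sum:
  assumes "derivation \<delta>"
  shows "\<delta> (sum f A) = (\<Sum>i\<in>A. \<delta> (f i))"
  by (induction A rule: infinite_finite_induct)
    (simp_all add: derivation_0[OF assms] derivation_add[OF assms])

lemma derivation_prod_eigen:
  assumes "derivation \<delta>" "\<And>i. i \<in> A \<Longrightarrow> \<delta> (f i) = c i * f i"
  shows "\<delta> (prod f A) = (\<Sum>i\<in>A. c i) * prod f A"
  using assms(2)
  by (induction A rule: infinite_finite_induct)
    (simp_all add: derivation_1[OF assms(1)] derivation_mult[OF assms(1)] algebra_simps)

lemma derivation_power:
  assumes "derivation \<delta>"
  shows "\<delta> (p ^ Suc n) = of_nat (Suc n) * p ^ n * \<delta> p"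
  by (induction n) (simp_all add: derivation_mult[OF assms] algebra_simps)

lemma derivation_eqI:
  assumes "derivation \<delta>" "derivation \<epsilon>" "\<And>i. \<delta> (Var i) = \<epsilon> (Var i)"
  shows "\<delta> = \<epsilon>"
proof
  fix p show "\<delta> p = \<epsilon> p"
    by (induction p rule: mpoly_var_induct)
      (simp_all add: assms derivation_Const[OF assms(1)] derivation_Const[OF assms(2)] derivation_add[OF assms(1)] derivation_add[OF assms(2)]
        derivation_mult[OF assms(1)] derivation_mult[OF assms(2)])
qed

text \<open>The criterion behind the squarefreeness proofs: by Leibniz, a square factor of
  \<open>p\<close> leaves one copy in every derivative.\<close>

lemma square_dvd_imp_dvd_derivation:
  assumes "derivation \<delta>" "r ^ 2 dvd p"
  shows "r dvd \<delta> p"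
proof -
  obtain t where t: "p = r * (r * t)" using assms(2) by (metis dvd_def mult.assoc power2_eq_square)
  have "\<delta> p = r * \<delta> (r * t) + r * (t * \<delta> r)"
    unfolding t derivation_mult[OF assms(1), of r "r * t"] by (simp only: mult_ac)
  then show ?thesis by simp
qed

text \<open>Modulo \<open>p\<close>, only \<open>q\<close> times the derivative of \<open>p\<close>
  survives in the Leibniz rule, and \<open>q\<close> cancels by coprimality. Being logarithmic can
  thus be tested on each coprime factor.\<close>

lemma dvd_derivation_mult_iff:
  fixes p q :: "('i::{finite, linorder}, 'k::idom) mpoly"
  assumes "derivation \<delta>" "coprime_to p q" "p \<noteq> 0"
  shows "p * q dvd \<delta> (p * q) \<longleftrightarrow> p dvd \<delta> p \<and> q dvd \<delta> q"
proof
  assume *: "p * q dvd \<delta> (p * q)"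
  then have "p dvd p * \<delta> q + q * \<delta> p" "q dvd p * \<delta> q + q * \<delta> p"
    unfolding derivation_mult[OF assms(1)] by (rule dvd_mult_left, rule dvd_mult_right)
  then have "p dvd q * \<delta> p" "q dvd p * \<delta> q"
    using dvd_add_right_iff[of p "p * \<delta> q" "q * \<delta> p"]
      dvd_add_left_iff[of q "q * \<delta> p" "p * \<delta> q"] dvd_triv_left by blast+
  then show "p dvd \<delta> p \<and> q dvd \<delta> q"
    using coprime_toD[OF assms(2)] coprime_toD[OF coprime_to_sym[OF assms(2,3)]] by blast
next
  assume "p dvd \<delta> p \<and> q dvd \<delta> q"
  then have "p * q dvd p * \<delta> q" "q * p dvd q * \<delta> p"
    by (simp_all add: mult_dvd_mono)
  then show "p * q dvd \<delta> (p * q)"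
    unfolding derivation_mult[OF assms(1), of p q] mult.commute[of q p] by (rule dvd_add)
qed

lemma dvd_derivation_prod_iff:
  fixes f :: "'a \<Rightarrow> ('i::{finite, linorder}, 'k::idom) mpoly"
  assumes "finite A" "derivation \<delta>" "\<And>i. i \<in> A \<Longrightarrow> f i \<noteq> 0"
    "\<And>i j. i \<in> A \<Longrightarrow> j \<in> A \<Longrightarrow> i \<noteq> j \<Longrightarrow> coprime_to (f i) (f j)"
  shows "prod f A dvd \<delta> (prod f A) \<longleftrightarrow> (\<forall>i\<in>A. f i dvd \<delta> (f i))"
  using assms(1,3,4)
proof (induction A rule: finite_induct)
  case (insert i A)
  have "coprime_to (f i) (prod f A)"
    by (rule coprime_to_prod) (use insert in auto)
  moreover have "prod f A dvd \<delta> (prod f A) \<longleftrightarrow> (\<forall>i\<in>A. f i dvd \<delta> (f i))"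
    by (rule insert.IH) (use insert.prems in auto)
  ultimately show ?case
    using dvd_derivation_mult_iff[OF assms(2), of "f i" "prod f A"] insert.prems(1)
    by (simp add: insert.hyps)
qed (simp add: derivation_1[OF assms(2)])

text \<open>The first-order coefficient of \<open>p (x + T c)\<close> in \<open>T\<close>, that is \<open>\<Sum>c i \<partial>p/\<partial>x i\<close>.\<close>

definition derivation_of ::
  "('i \<Rightarrow> ('i, 'k) mpoly) \<Rightarrow> ('i::finite, 'k::comm_ring_1) mpoly \<Rightarrow> ('i, 'k) mpoly" where
  "derivation_of c p = coeff (subst (\<lambda>i. [:Var i, c i:]) p) 1"

lemma derivation_derivation_of: "derivation (derivation_of c)"
proof -
  \<comment> \<open>Setting the outer variable to 0 recovers \<open>p\<close>, so the coefficient of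
    degree 1 in a product is the Leibniz rule.\<close>
  have "coeff (subst (\<lambda>i. [:Var i, c i:]) p) 0 = p" for p
    using poly_subst_eq[of "\<lambda>i. [:Var i, c i:]" 0 p] by (simp add: poly_0_coeff_0)
  then show ?thesis
    unfolding derivation_def derivation_of_def
    by (simp add: subst_add subst_mult coeff_mult mult.commute)
qed

lemma derivation_of_Var [simp]: "derivation_of c (Var i) = c i"
  by (simp add: derivation_of_def)

section \<open>Linear combinations of derivations and a criterion for freeness\<close>

lemma derivation_sum_scale:
  assumes "\<And>j. j \<in> A \<Longrightarrow> derivation (D j)"
  shows "derivation (\<Sum>j\<in>A. fun_scale (l j) (D j))"
proof -
  \<comment> \<open>As 1 divides everything, \<open>Der 1\<close> is the module of all derivations,
    and \<open>subspace_Der\<close> applies.\<close>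
  have "(\<Sum>j\<in>A. fun_scale (l j) (D j)) \<in> Der 1"
    using assms
    by (intro fun_module.subspace_sum fun_module.subspace_scale subspace_Der) (auto simp: Der_def)
  then show ?thesis by (simp add: Der_def)
qed

lemma sum_scale_apply: "(\<Sum>j\<in>A. fun_scale (l j) (D j)) p = (\<Sum>j\<in>A. l j * D j p)"
  by (induction A rule: infinite_finite_induct) (simp_all add: fun_scale_def)

lemma free_submoduleI:
  fixes D :: "'j::finite \<Rightarrow> 'b \<Rightarrow> 'a::comm_ring_1"
  assumes M: "fun_module.subspace M" "\<And>j. D j \<in> M"
    and gen: "\<And>\<delta>. \<delta> \<in> M \<Longrightarrow> \<exists>l. \<delta> = (\<Sum>j\<in>UNIV. fun_scale (l j) (D j))"
    and ind: "\<And>l j. (\<Sum>j\<in>UNIV. fun_scale (l j) (D j)) = 0 \<Longrightarrow> l j = 0"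
  shows "free_submodule M"
proof -
  have inj: "inj D"
  proof (rule injI)
    fix i j assume ij: "D i = D j"
    show "i = j"
    proof (rule ccontr)
      assume ne: "i \<noteq> j"
      \<comment> \<open>Independence in \<open>free_submodule\<close> concerns a set, so the family
        must be injective. Equal members would satisfy the relation with coefficients 1 and
        -1.\<close>
      define l :: "'j \<Rightarrow> 'a" where "l k = (if k = i then 1 else 0) - (if k = j then 1 else 0)" for k
      have "(\<Sum>k\<in>UNIV. fun_scale (l k) (D k)) = 0"
      proof
        fix x
        have "(\<Sum>k\<in>UNIV. l k * D k x) =
          (\<Sum>k\<in>UNIV. (if k = i then D k x else 0) - (if k = j then D k x else 0))"
          by (intro sum.cong) (auto simp: l_def)
        then show "(\<Sum>k\<in>UNIV. fun_scale (l k) (D k)) x = 0 x"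
          using ij by (simp add: sum_scale_apply sum_subtractf)
      qed
      then have "l i = 0" by (rule ind)
      then show False using ne by (simp add: l_def)
    qed
  qed
  have reindex: "(\<Sum>v\<in>range D. fun_scale (u v) v) = (\<Sum>j\<in>UNIV. fun_scale (u (D j)) (D j))" for u
    by (simp add: sum.reindex[OF inj] o_def)
  have "fun_module.independent (range D)"
    unfolding fun_module.dependent_finite[OF finite_imageI[OF finite_UNIV]] reindex
    using ind[of "\<lambda>j. _ (D j)"] by blast
  moreover have "fun_module.span (range D) = M"
  proof
    show "fun_module.span (range D) \<subseteq> M"
      using M by (intro fun_module.span_minimal) auto
    show "M \<subseteq> fun_module.span (range D)"
    proof
      fix \<delta> assume "\<delta> \<in> M"
      then obtain l where "\<delta> = (\<Sum>j\<in>UNIV. fun_scale (l j) (D j))" using gen by blast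
      then show "\<delta> \<in> fun_module.span (range D)"
        by (simp only:) (intro fun_module.span_sum fun_module.span_scale fun_module.span_base rangeI)
    qed
  qed
  ultimately show ?thesis unfolding free_submodule_def by blast
qed

section \<open>Sums of monomials with one factor omitted\<close>

locale hat_sums =
  fixes r :: "'i::{finite, linorder} \<Rightarrow> nat" and y :: "'i \<Rightarrow> ('i, 'k::field_char_0) mpoly"
  assumes r_pos: "\<And>i. r i > 0" and y_def: "\<And>i. y i = Var i ^ r i"
begin

text \<open>The set \<open>U\<close> is a parameter because the omitted products occur both over all
  variables and within each of the two groups.\<close>

definition hat :: "'i set \<Rightarrow> 'i \<Rightarrow> ('i, 'k) mpoly" where
  "hat U i = (\<Prod>j\<in>U - {i}. y j)"

definition hsum :: "'i set \<Rightarrow> 'i set \<Rightarrow> ('i, 'k) mpoly" where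
  "hsum U G = (\<Sum>i\<in>G. hat U i)"

text \<open>The derivation with coefficients \<open>c i\<close> along the scaled Euler fields.
  Dividing by \<open>r i\<close>, possible in characteristic 0, makes \<open>y i\<close> an
  eigenvector with eigenvalue \<open>c i\<close>.\<close>

definition lder :: "('i \<Rightarrow> ('i, 'k) mpoly) \<Rightarrow> ('i, 'k) mpoly \<Rightarrow> ('i, 'k) mpoly" where
  "lder c = derivation_of (\<lambda>i. Const (1 / of_nat (r i)) * c i * Var i)"

lemma y_nonzero: "y i \<noteq> 0"
  by (simp add: y_def)

lemma y_in: "i \<in> I \<Longrightarrow> y i \<in> polys_in I"
  by (simp add: y_def polys_in_power polys_in_Var)

lemma Var_dvd_y_iff: "Var i dvd y j \<longleftrightarrow> i = j"
proof
  assume "Var i dvd y j"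
  then show "i = j"
    using prime_elem_dvd_power[OF prime_elem_Var] Var_dvd_Var_iff unfolding y_def by blast
next
  assume "i = j"
  then show "Var i dvd y j" using r_pos[of j] by (simp add: y_def dvd_power)
qed

lemma y_mult_hat: "i \<in> U \<Longrightarrow> y i * hat U i = prod y U"
  by (simp add: hat_def prod.remove[of U i])

lemma y_dvd_hat: "j \<in> U \<Longrightarrow> j \<noteq> i \<Longrightarrow> y j dvd hat U i"
  unfolding hat_def by (intro dvd_prodI) auto

lemma Var_not_dvd_hat: "\<not> Var i dvd hat U i"
proof
  assume "Var i dvd hat U i"
  then obtain j where "j \<in> U - {i}" "Var i dvd y j"
    unfolding hat_def by (rule prime_elem_dvd_prod[OF prime_elem_Var, THEN bexE])
  then show False by (simp add: Var_dvd_y_iff)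
qed

lemma coprime_y_hat: "coprime_to (y i) (hat U i)"
  unfolding y_def[of i]
  by (intro coprime_to_power_left prime_elem_coprime_to prime_elem_Var Var_not_dvd_hat) simp

text \<open>Every summand except \<open>hat U i\<close> contains the factor
  \<open>y i\<close>.\<close>

lemma Var_not_dvd_hsum:
  assumes "i \<in> G" "G \<subseteq> U"
  shows "\<not> Var i dvd hsum U G"
proof
  assume *: "Var i dvd hsum U G"
  have "Var i dvd (\<Sum>j\<in>G - {i}. hat U j)"
  proof (intro dvd_sum)
    fix j assume "j \<in> G - {i}"
    then have "y i dvd hat U j" using assms by (intro y_dvd_hat) auto
    then show "Var i dvd hat U j" using Var_dvd_y_iff dvd_trans by blast
  qed
  moreover have "hsum U G = hat U i + (\<Sum>j\<in>G - {i}. hat U j)"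
    unfolding hsum_def using assms by (intro sum.remove) auto
  ultimately have "Var i dvd hat U i" using * dvd_add_left_iff by metis
  then show False using Var_not_dvd_hat by blast
qed

lemma hsum_nonzero:
  assumes "G \<noteq> {}" "G \<subseteq> U"
  shows "hsum U G \<noteq> 0"
proof -
  obtain i where "i \<in> G" using assms(1) by blast
  then show ?thesis using Var_not_dvd_hsum[of i G U] assms(2) by auto
qed

lemma hsum_in: "hsum G G \<in> polys_in G"
  unfolding hsum_def hat_def by (intro polys_in_sum polys_in_prod y_in) auto

lemma Var_not_dvd_hsum_self:
  assumes "G \<noteq> {}"
  shows "\<not> Var i dvd hsum G G"
proof (cases "i \<in> G")
  \<comment> \<open>Here \<open>hsum G G\<close> does not involve the variable, and neither do its
    divisors.\<close>
  case False
  show ?thesis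
  proof
    assume "Var i dvd hsum G G"
    then have "Var i \<in> (polys_in G :: ('i, 'k) mpoly set)"
      using hsum_in hsum_nonzero[OF assms order_refl] by (rule polys_in_dvd)
    then have "degree (uni i (Var i :: ('i, 'k) mpoly)) = 0"
      using False unfolding polys_in_iff_degree by blast
    then show False by simp
  qed
qed (simp add: Var_not_dvd_hsum)

lemma coprime_Var_hsum: "G \<noteq> {} \<Longrightarrow> coprime_to (Var i) (hsum G G)"
  by (intro prime_elem_coprime_to prime_elem_Var Var_not_dvd_hsum_self)

lemma coprime_y_hsum: "G \<noteq> {} \<Longrightarrow> coprime_to (y i) (hsum G G)"
  unfolding y_def[of i] by (intro coprime_to_power_left coprime_Var_hsum) simp_all

text \<open>A common irreducible factor could only involve variables lying in both of the disjoint
  sets, so it would be constant.\<close>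

lemma coprime_hsums:
  assumes "G \<noteq> {}" "H \<noteq> {}" "G \<inter> H = {}"
  shows "coprime_to (hsum G G) (hsum H H)"
proof (rule coprime_toI_irreducible)
  fix p assume p: "irreducible p" "p dvd hsum G G"
  show "\<not> p dvd hsum H H"
  proof
    assume "p dvd hsum H H"
    then have "p \<in> polys_in H"
      using hsum_in hsum_nonzero[OF assms(2) order_refl] by (rule polys_in_dvd)
    moreover have "p \<in> polys_in G"
      using p(2) hsum_in hsum_nonzero[OF assms(1) order_refl] by (rule polys_in_dvd)
    ultimately have "p \<in> polys_in {}" using polys_in_Int[of p G H] assms(3) by simp
    then have "p dvd 1" using p(1) by (intro polys_in_empty_unit) auto
    then show False using p(1) by (simp add: irreducible_def)
  qed
qed (use assms hsum_nonzero in auto)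

lemma hat_UNIV:
  assumes "i \<in> H"
  shows "hat UNIV i = prod y (- H) * hat H i"
proof -
  have "UNIV - {i} = - H \<union> (H - {i})" using assms by auto
  moreover have "prod y (- H \<union> (H - {i})) = prod y (- H) * prod y (H - {i})"
    by (rule prod.union_disjoint) auto
  ultimately show ?thesis unfolding hat_def by simp
qed

lemma hsum_UNIV: "hsum UNIV H = prod y (- H) * hsum H H"
  by (simp add: hsum_def sum_distrib_left hat_UNIV)

lemma derivation_lder: "derivation (lder c)"
  unfolding lder_def by (rule derivation_derivation_of)

lemma lder_Var: "lder c (Var i) = Const (1 / of_nat (r i)) * c i * Var i"
  by (simp add: lder_def)

lemma of_nat_mpoly: "(of_nat n :: ('i, 'k) mpoly) = Const (of_nat n)"
  by (simp add: Const_def)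

lemma lder_y: "lder c (y i) = c i * y i"
proof -
  obtain n where n: "r i = Suc n" using r_pos[of i] by (cases "r i") auto
  have "(of_nat (Suc n) :: ('i, 'k) mpoly) * Const (1 / of_nat (Suc n)) = 1"
    unfolding of_nat_mpoly Const_mult[symmetric] by (simp del: of_nat_Suc)
  moreover have "lder c (y i) = (of_nat (Suc n) * Const (1 / of_nat (Suc n))) * (c i * (Var i * Var i ^ n))"
    unfolding y_def[of i] n derivation_power[OF derivation_lder] lder_Var by (simp only: mult_ac)
  ultimately show ?thesis by (simp add: y_def[of i] n)
qed

text \<open>Each \<open>hat U i\<close> is an eigenvector; its eigenvalue is the sum of
  \<open>c\<close> over \<open>U\<close> without \<open>c i\<close>.\<close>

lemma lder_hsum:
  assumes "G \<subseteq> U"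
  shows "lder c (hsum U G) = sum c U * hsum U G - (\<Sum>i\<in>G. c i * hat U i)"
proof -
  have "lder c (hat U i) = sum c U * hat U i - c i * hat U i" if "i \<in> G" for i
  proof -
    have "lder c (hat U i) = sum c (U - {i}) * hat U i"
      unfolding hat_def by (rule derivation_prod_eigen[OF derivation_lder lder_y])
    also have "sum c (U - {i}) = sum c U - c i"
      using that assms by (subst sum_diff1) auto
    finally show ?thesis by (simp add: algebra_simps)
  qed
  then show ?thesis
    by (simp add: hsum_def derivation_sum[OF derivation_lder] sum_subtractf sum_distrib_left)
qed

lemma syzygyE:
  assumes "(\<Sum>i\<in>U. c i * hat U i) = e * hsum U U"
  obtains d where "\<And>i. i \<in> U \<Longrightarrow> c i = e + d i * y i" "sum d U = 0"
proof -
  have 0: "(\<Sum>i\<in>U. (c i - e) * hat U i) = 0"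
    using assms by (simp add: hsum_def left_diff_distrib sum_subtractf sum_distrib_left)
  have "\<exists>d. c i = e + d * y i" if i: "i \<in> U" for i
  proof -
    have "(c i - e) * hat U i + (\<Sum>j\<in>U - {i}. (c j - e) * hat U j) = 0"
      using 0 i sum.remove[of U i "\<lambda>j. (c j - e) * hat U j"] by simp
    then have "hat U i * (c i - e) = - (\<Sum>j\<in>U - {i}. (c j - e) * hat U j)"
      by (simp add: eq_neg_iff_add_eq_0 mult.commute)
    moreover have "y i dvd (\<Sum>j\<in>U - {i}. (c j - e) * hat U j)"
      using i by (intro dvd_sum dvd_mult y_dvd_hat) auto
    ultimately have "y i dvd hat U i * (c i - e)" by simp
    then have "y i dvd c i - e" by (rule coprime_toD[OF coprime_y_hat])
    then obtain d where "c i - e = y i * d" by blast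
    then have "c i = e + d * y i" by (simp add: diff_eq_eq mult.commute add.commute)
    then show ?thesis by blast
  qed
  then obtain d where d: "\<And>i. i \<in> U \<Longrightarrow> c i = e + d i * y i" by metis
  \<comment> \<open>After substitution every summand is a multiple of the same monomial
    \<open>prod y U\<close>, which cancels.\<close>
  have "(\<Sum>i\<in>U. (c i - e) * hat U i) = (\<Sum>i\<in>U. d i * prod y U)"
    using d by (intro sum.cong) (simp_all add: mult.assoc y_mult_hat)
  then have "sum d U * prod y U = 0" using 0 by (simp add: sum_distrib_right)
  then have "sum d U = 0" by (simp add: y_nonzero)
  with d show ?thesis by (rule that)
qed

lemma syzygyI:
  assumes "\<And>i. i \<in> U \<Longrightarrow> c i = e + d i * y i" "sum d U = 0"
  shows "(\<Sum>i\<in>U. c i * hat U i) = e * hsum U U"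
proof -
  have "(\<Sum>i\<in>U. c i * hat U i) = (\<Sum>i\<in>U. e * hat U i + d i * prod y U)"
    using assms(1) by (intro sum.cong) (simp_all add: distrib_right mult.assoc y_mult_hat)
  then show ?thesis
    using assms(2) by (simp add: sum.distrib hsum_def sum_distrib_left flip: sum_distrib_right)
qed

text \<open>With \<open>c\<close> the indicator of one index \<open>i\<close> of \<open>G\<close>, a
  square factor divides both \<open>hsum G G\<close> and its derivative, hence their difference
  \<open>hat G i\<close>. That monomial is coprime to \<open>hsum G G\<close>.\<close>

lemma squarefree_hsum:
  assumes "G \<noteq> {}"
  shows "squarefree (hsum G G)"
  unfolding squarefree_def
proof (intro allI impI)
  fix t assume t: "t ^ 2 dvd hsum G G"
  obtain i where i: "i \<in> G" using assms by blast
  define c :: "'i \<Rightarrow> ('i, 'k) mpoly" where "c j = (if j = i then 1 else 0)" for j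
  have "(\<Sum>j\<in>G. c j * hat G j) = (\<Sum>j\<in>G. if j = i then hat G j else 0)"
    by (intro sum.cong) (auto simp: c_def)
  then have "lder c (hsum G G) = hsum G G - hat G i"
    using i unfolding lder_hsum[OF order_refl] by (simp add: c_def)
  then have eq: "hat G i = hsum G G - lder c (hsum G G)" by simp
  have dvd: "t dvd hsum G G" using t by (metis dvd_mult_left power2_eq_square)
  moreover have "t dvd hat G i"
    unfolding eq using dvd square_dvd_imp_dvd_derivation[OF derivation_lder t] by (rule dvd_diff)
  moreover have "coprime_to (hsum G G) (hat G i)"
    unfolding hat_def using assms y_nonzero
    by (intro coprime_to_prod coprime_to_sym[OF coprime_y_hsum])
  ultimately show "t dvd 1" using assms hsum_nonzero coprime_to_unit by blast
qed

end

section \<open>The pencil spanned by the two sums\<close>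

text \<open>\<open>G\<close> and its complement are the two groups of variables, with chosen members
  \<open>p\<close> and \<open>q\<close>. The set \<open>I\<close> indexes the members of the pencil
  and may be empty, in which case \<open>Q = 1\<close>.\<close>

locale pencil = hat_sums r y
  for r :: "'i::{finite, linorder} \<Rightarrow> nat" and y :: "'i \<Rightarrow> ('i, 'k::field_char_0) mpoly" +
  fixes G :: "'i set" and p q :: 'i and I :: "'n set" and a b :: "'n \<Rightarrow> 'k"
  assumes p: "p \<in> G" and q: "q \<notin> G" and I: "finite I"
    and ab: "\<And>k. k \<in> I \<Longrightarrow> a k \<noteq> 0" "\<And>k. k \<in> I \<Longrightarrow> b k \<noteq> 0"
    and distinct: "\<And>k l. k \<in> I \<Longrightarrow> l \<in> I \<Longrightarrow> k \<noteq> l \<Longrightarrow> a k * b l \<noteq> a l * b k"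
begin

abbreviation "g1 \<equiv> hsum (- G) (- G)"
abbreviation "g2 \<equiv> hsum G G"
abbreviation "f1 \<equiv> hsum UNIV (- G)"
abbreviation "f2 \<equiv> hsum UNIV G"

definition "P k = Const (a k) * f1 + Const (b k) * f2"

definition "Q = prod P I"

definition "F = prod Var UNIV * g2 * g1"

section \<open>Coprimality and squarefreeness of the factors\<close>

lemma nonempty: "G \<noteq> {}" "- G \<noteq> {}"
  using p q by auto

lemma f1_eq: "f1 = prod y G * g1" and f2_eq: "f2 = prod y (- G) * g2"
  using hsum_UNIV[of "- G"] hsum_UNIV[of G] by simp_all

lemma g_nonzero: "g1 \<noteq> 0" "g2 \<noteq> 0" and f_nonzero: "f1 \<noteq> 0" "f2 \<noteq> 0"
  using nonempty by (simp_all add: hsum_nonzero)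

lemma coprime_y_y: "i \<noteq> j \<Longrightarrow> coprime_to (y i) (y j)"
  unfolding y_def[of i] y_def[of j]
  by (intro coprime_to_power_left coprime_to_power coprime_Var_Var) simp_all

lemma coprime_g1_g2: "coprime_to g1 g2"
  using nonempty by (intro coprime_hsums) auto

lemma coprime_f1_f2: "coprime_to f1 f2"
proof -
  have "coprime_to (prod y G) (prod y (- G))"
    by (intro coprime_to_prod_left coprime_to_prod coprime_y_y) (auto simp: y_nonzero)
  moreover have "coprime_to (prod y G) g2"
    using nonempty by (intro coprime_to_prod_left coprime_y_hsum) (auto simp: y_nonzero)
  moreover have "coprime_to g1 (prod y (- G))"
    using nonempty by (intro coprime_to_prod coprime_to_sym[OF coprime_y_hsum]) (auto simp: y_nonzero)
  ultimately show ?thesis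
    unfolding f1_eq f2_eq using coprime_g1_g2
    by (intro coprime_to_mult_left coprime_to_mult) (simp_all add: y_nonzero)
qed

lemma Var_dvd_f1: "i \<in> G \<Longrightarrow> Var i dvd f1"
  unfolding f1_eq
  by (intro dvd_mult2 dvd_trans[OF _ dvd_prodI[of G i]]) (auto simp: Var_dvd_y_iff)

lemma Var_dvd_f2: "i \<notin> G \<Longrightarrow> Var i dvd f2"
  unfolding f2_eq
  by (intro dvd_mult2 dvd_trans[OF _ dvd_prodI[of "- G" i]]) (auto simp: Var_dvd_y_iff)

text \<open>Modulo a variable of \<open>G\<close> the term with \<open>f1\<close> vanishes, while
  \<open>f2\<close> survives with nonzero coefficient \<open>b k\<close>; for the other variables
  the roles are exchanged.\<close>

lemma Var_not_dvd_P:
  assumes "k \<in> I"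
  shows "\<not> Var i dvd P k"
proof
  assume *: "Var i dvd P k"
  show False
  proof (cases "i \<in> G")
    case True
    then have "Var i dvd Const (b k) * f2"
      using * Var_dvd_f1[of i] dvd_add_right_iff[of "Var i" "Const (a k) * f1" "Const (b k) * f2"]
      unfolding P_def by (metis dvd_mult)
    then show False
      using Var_not_dvd_hsum[OF True] ab(2)[OF assms] by (simp add: Const_unit_dvd_iff)
  next
    case False
    then have "Var i dvd Const (a k) * f1"
      using * Var_dvd_f2[of i] dvd_add_left_iff[of "Var i" "Const (b k) * f2" "Const (a k) * f1"]
      unfolding P_def by (metis dvd_mult)
    then show False
      using Var_not_dvd_hsum[of i "- G" UNIV] False ab(1)[OF assms] by (simp add: Const_unit_dvd_iff)
  qed
qed

lemma P_nonzero: "k \<in> I \<Longrightarrow> P k \<noteq> 0"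
  using Var_not_dvd_P[of k p] by auto

lemma Q_nonzero: "Q \<noteq> 0"
  unfolding Q_def using I P_nonzero by simp

lemma coprime_Var_P: "k \<in> I \<Longrightarrow> coprime_to (Var i) (P k)"
  by (intro prime_elem_coprime_to prime_elem_Var Var_not_dvd_P)

lemma coprime_P_y: "k \<in> I \<Longrightarrow> coprime_to (P k) (y i)"
  unfolding y_def[of i] by (rule coprime_to_power[OF coprime_to_sym[OF coprime_Var_P]]) simp_all

lemma coprime_f1_P:
  assumes "k \<in> I"
  shows "coprime_to f1 (P k)"
proof -
  have "coprime_to f1 (Const (b k) * f2 + Const (a k) * f1)"
    using ab(2)[OF assms] by (intro coprime_to_linear coprime_f1_f2 Const_dvd_1)
  then show ?thesis unfolding P_def by (subst add.commute)
qed

lemma coprime_f2_P: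
  assumes "k \<in> I"
  shows "coprime_to f2 (P k)"
  unfolding P_def using ab(1)[OF assms] f_nonzero(1)
  by (intro coprime_to_linear coprime_to_sym[OF coprime_f1_f2] Const_dvd_1)

lemma coprime_P_f1: "k \<in> I \<Longrightarrow> coprime_to (P k) f1"
  by (rule coprime_to_sym[OF coprime_f1_P f_nonzero(1)])

lemma coprime_P_g1: "k \<in> I \<Longrightarrow> coprime_to (P k) g1"
  using coprime_to_dvd[OF coprime_P_f1] unfolding f1_eq by simp

lemma coprime_P_g2:
  assumes "k \<in> I"
  shows "coprime_to (P k) g2"
proof -
  have "coprime_to (P k) f2" by (rule coprime_to_sym[OF coprime_f2_P[OF assms] f_nonzero(2)])
  then show ?thesis by (rule coprime_to_dvd) (simp add: f2_eq)
qed

lemma coprime_P_P: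
  assumes "k \<in> I" "l \<in> I" "k \<noteq> l"
  shows "coprime_to (P k) (P l)"
proof -
  \<comment> \<open>Here \<open>t\<close> matches the coefficients of \<open>f2\<close>, so
    \<open>P l\<close> is congruent to \<open>c * f1\<close> modulo \<open>P k\<close>. That
    \<open>c\<close> is nonzero means that the two points are distinct.\<close>
  define c t where "c = a l - b l / b k * a k" and "t = b l / b k"
  have "c \<noteq> 0"
    using distinct[OF assms] ab(2)[OF assms(1)] unfolding c_def
    by (simp add: field_simps)
  moreover have "Const (a l) = (Const c + Const t * Const (a k) :: ('i, 'k) mpoly)"
    by (simp add: c_def t_def flip: Const_add Const_mult)
  moreover have "Const (b l) = (Const t * Const (b k) :: ('i, 'k) mpoly)"
    using ab(2)[OF assms(1)] by (simp add: t_def flip: Const_mult)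
  ultimately have "P l = Const c * f1 + Const t * P k"
    unfolding P_def by (simp add: algebra_simps)
  then show ?thesis
    using coprime_to_linear[OF coprime_P_f1[OF assms(1)] Const_dvd_1[OF \<open>c \<noteq> 0\<close>]] by simp
qed

lemma squarefree_P:
  assumes k: "k \<in> I"
  shows "squarefree (P k)"
  unfolding squarefree_def
proof (intro allI impI)
  fix t assume t: "t ^ 2 dvd P k"
  \<comment> \<open>The derivation attached to the index \<open>p\<close> alone fixes
    \<open>f1\<close> and changes \<open>f2\<close> by \<open>hat UNIV p\<close>. A square factor of
    \<open>P k\<close> thus divides that monomial, to which \<open>P k\<close> is coprime.\<close>
  define c :: "'i \<Rightarrow> ('i, 'k) mpoly" where "c j = (if j = p then 1 else 0)" for j
  have "(\<Sum>j\<in>A. c j * hat UNIV j) = (\<Sum>j\<in>A. if j = p then hat UNIV j else 0)" for A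
    by (intro sum.cong) (simp_all add: c_def)
  then have "(\<Sum>j\<in>A. c j * hat UNIV j) = (if p \<in> A then hat UNIV p else 0)" for A
    by simp
  moreover have "sum c UNIV = 1" by (simp add: c_def)
  ultimately have l: "lder c f2 = f2 - hat UNIV p" "lder c f1 = f1"
    using p by (simp_all add: lder_hsum)
  have eq: "Const (b k) * hat UNIV p = P k - lder c (P k)"
    unfolding P_def derivation_add[OF derivation_lder] derivation_Const_mult[OF derivation_lder] l
    by (simp add: algebra_simps)
  have dvd: "t dvd P k" using t by (metis dvd_mult_left power2_eq_square)
  moreover have "t dvd Const (b k) * hat UNIV p"
    unfolding eq using dvd square_dvd_imp_dvd_derivation[OF derivation_lder t] by (rule dvd_diff)
  then have "t dvd hat UNIV p" using ab(2)[OF k] by (simp add: Const_unit_dvd_iff)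
  moreover have "coprime_to (P k) (hat UNIV p)"
    unfolding hat_def by (rule coprime_to_prod) (rule coprime_P_y[OF k])
  ultimately show "t dvd 1" using P_nonzero[OF k] coprime_to_unit by blast
qed

lemma coprime_Vars_g2: "coprime_to (prod Var UNIV) g2"
  and coprime_Vars_g1: "coprime_to (prod Var UNIV) g1"
  using nonempty by (auto intro!: coprime_to_prod_left coprime_Var_hsum)

lemma coprime_Vars_g2_g1: "coprime_to (prod Var UNIV * g2) g1"
  using coprime_Vars_g1 coprime_to_sym[OF coprime_g1_g2] g_nonzero
  by (intro coprime_to_mult_left) auto

lemma F_nonzero: "F \<noteq> 0"
  by (simp add: F_def g_nonzero)

lemma coprime_F_Q: "coprime_to F Q"
  unfolding F_def Q_def
proof (intro coprime_to_prod coprime_to_mult_left coprime_to_prod_left)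
  fix k assume k: "k \<in> I"
  show "coprime_to g2 (P k)" "coprime_to g1 (P k)"
    using coprime_to_sym[OF coprime_P_g1[OF k] P_nonzero[OF k]]
      coprime_to_sym[OF coprime_P_g2[OF k] P_nonzero[OF k]] by blast+
qed (simp_all add: g_nonzero coprime_Var_P)

lemma squarefree_F: "squarefree F"
proof -
  have "squarefree (prod Var UNIV :: ('i, 'k) mpoly)"
  proof (rule squarefree_prod_coprime_to)
    show "squarefree (Var i :: ('i, 'k) mpoly)" for i
      by (rule squarefree_irreducible[OF prime_elem_irreducible[OF prime_elem_Var]])
  qed (simp_all add: coprime_Var_Var)
  then have "squarefree (prod Var UNIV * g2)"
    by (rule squarefree_mult_coprime_to[OF _ squarefree_hsum coprime_Vars_g2])
      (simp_all add: nonempty g_nonzero)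
  then show ?thesis
    unfolding F_def
    by (rule squarefree_mult_coprime_to[OF _ squarefree_hsum coprime_Vars_g2_g1])
      (simp_all add: nonempty g_nonzero)
qed

lemma squarefree_F_Q: "squarefree (F * Q)"
proof (rule squarefree_mult_coprime_to[OF squarefree_F _ coprime_F_Q F_nonzero Q_nonzero])
  show "squarefree Q"
    unfolding Q_def by (intro squarefree_prod_coprime_to squarefree_P P_nonzero coprime_P_P)
qed

section \<open>Logarithmic derivations of \<open>F * Q\<close> in terms of their
  coefficients\<close>

lemma F_Q_dvd_derivation_iff:
  assumes "derivation \<delta>"
  shows "F * Q dvd \<delta> (F * Q) \<longleftrightarrow> (\<forall>i. Var i dvd \<delta> (Var i)) \<and> g2 dvd \<delta> g2 \<and> g1 dvd \<delta> g1 \<and>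
    (\<forall>k\<in>I. P k dvd \<delta> (P k))"
proof -
  have "prod Var UNIV dvd \<delta> (prod Var UNIV) \<longleftrightarrow> (\<forall>i. Var i dvd \<delta> (Var i))"
    by (subst dvd_derivation_prod_iff) (auto intro: assms coprime_Var_Var)
  moreover have "Q dvd \<delta> Q \<longleftrightarrow> (\<forall>k\<in>I. P k dvd \<delta> (P k))"
    unfolding Q_def
    by (rule dvd_derivation_prod_iff) (auto intro: assms coprime_P_P I dest: P_nonzero)
  ultimately show ?thesis
    unfolding dvd_derivation_mult_iff[OF assms coprime_F_Q F_nonzero]
    unfolding F_def
    by (simp add: dvd_derivation_mult_iff assms coprime_Vars_g2_g1 coprime_Vars_g2 g_nonzero)
qed

text \<open>Both \<open>f1\<close> and \<open>f2\<close> are eigenvectors, with eigenvalues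
  \<open>C - e1\<close> and \<open>C - e2\<close>. Modulo \<open>P k\<close> only a nonzero constant
  times \<open>f1 * (e1 - e2)\<close> remains, and \<open>f1\<close> is coprime to
  \<open>P k\<close>.\<close>

lemma P_dvd_lder_iff:
  assumes "k \<in> I" and e2: "(\<Sum>i\<in>G. c i * hat G i) = e2 * g2"
    and e1: "(\<Sum>i\<in>-G. c i * hat (- G) i) = e1 * g1"
  shows "P k dvd lder c (P k) \<longleftrightarrow> P k dvd e1 - e2"
proof -
  define C where "C = sum c UNIV"
  have "(\<Sum>i\<in>G. c i * hat UNIV i) = prod y (- G) * (\<Sum>i\<in>G. c i * hat G i)"
    unfolding sum_distrib_left by (intro sum.cong) (simp_all add: hat_UNIV[of _ G] mult_ac)
  also have "\<dots> = e2 * f2" unfolding e2 f2_eq by (rule mult.left_commute)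
  finally have 2: "lder c f2 = (C - e2) * f2"
    by (simp add: lder_hsum C_def left_diff_distrib)
  have "(\<Sum>i\<in>-G. c i * hat UNIV i) = prod y G * (\<Sum>i\<in>-G. c i * hat (- G) i)"
    unfolding sum_distrib_left by (intro sum.cong) (simp_all add: hat_UNIV[of _ "- G"] mult_ac)
  also have "\<dots> = e1 * f1" unfolding e1 f1_eq by (rule mult.left_commute)
  finally have 1: "lder c f1 = (C - e1) * f1"
    by (simp add: lder_hsum C_def left_diff_distrib)
  have "lder c (P k) = P k * (C - e2) - Const (a k) * (f1 * (e1 - e2))"
    unfolding P_def derivation_add[OF derivation_lder] derivation_Const_mult[OF derivation_lder] 1 2
    by (simp add: algebra_simps)
  then have "P k dvd lder c (P k) \<longleftrightarrow> P k dvd Const (a k) * (f1 * (e1 - e2))"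
    by (metis dvd_diff_right_iff dvd_triv_left)
  also have "\<dots> \<longleftrightarrow> P k dvd f1 * (e1 - e2)"
    using ab(1)[OF assms(1)] by (rule Const_unit_dvd_iff)
  also have "\<dots> \<longleftrightarrow> P k dvd e1 - e2"
    by (rule iffI[OF coprime_toD[OF coprime_P_f1[OF assms(1)]] dvd_mult])
  finally show ?thesis .
qed

lemma hsum_dvd_lder_iff:
  "hsum U U dvd lder c (hsum U U) \<longleftrightarrow> (\<exists>e. (\<Sum>i\<in>U. c i * hat U i) = e * hsum U U)"
proof -
  have "hsum U U dvd lder c (hsum U U) \<longleftrightarrow> hsum U U dvd (\<Sum>i\<in>U. c i * hat U i)"
    unfolding lder_hsum[OF order_refl, of c U] by (rule dvd_diff_right_iff[OF dvd_triv_right])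
  then show ?thesis by (auto simp: dvd_def mult.commute)
qed

lemma lder_in_Der_iff:
  "lder c \<in> Der (F * Q) \<longleftrightarrow> (\<exists>e1 e2. (\<Sum>i\<in>G. c i * hat G i) = e2 * g2 \<and>
    (\<Sum>i\<in>-G. c i * hat (- G) i) = e1 * g1 \<and> Q dvd e1 - e2)"
proof -
  have Q: "Q dvd z \<longleftrightarrow> (\<forall>k\<in>I. P k dvd z)" for z
    unfolding Q_def by (intro prod_dvd_iff_coprime_to I P_nonzero coprime_P_P)
  have "Var i dvd lder c (Var i)" for i by (simp add: lder_Var)
  then have "lder c \<in> Der (F * Q) \<longleftrightarrow> g2 dvd lder c g2 \<and> g1 dvd lder c g1 \<and>
    (\<forall>k\<in>I. P k dvd lder c (P k))"
    by (simp add: Der_def derivation_lder F_Q_dvd_derivation_iff)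
  also have "\<dots> \<longleftrightarrow> (\<exists>e1 e2. (\<Sum>i\<in>G. c i * hat G i) = e2 * g2 \<and>
    (\<Sum>i\<in>-G. c i * hat (- G) i) = e1 * g1 \<and> Q dvd e1 - e2)"
    unfolding hsum_dvd_lder_iff Q using P_dvd_lder_iff by fast
  finally show ?thesis .
qed

lemma Der_eq_lder:
  assumes "\<delta> \<in> Der (F * Q)"
  shows "\<exists>c. \<delta> = lder c"
proof -
  have der: "derivation \<delta>" using assms by (simp add: Der_def)
  have "\<forall>i. Var i dvd \<delta> (Var i)" using assms F_Q_dvd_derivation_iff[OF der] by (simp add: Der_def)
  then obtain t where t: "\<And>i. \<delta> (Var i) = Var i * t i" unfolding dvd_def by metis
  \<comment> \<open>The factor \<open>r i\<close> undoes the scaling in \<open>lder\<close>.\<close>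
  have "\<delta> = lder (\<lambda>i. of_nat (r i) * t i)"
  proof (rule derivation_eqI[OF der derivation_lder])
    fix i
    have "Const (1 / of_nat (r i)) * of_nat (r i) = (1 :: ('i, 'k) mpoly)"
      using r_pos[of i] unfolding of_nat_mpoly Const_mult[symmetric] by simp
    then have "Const (1 / of_nat (r i)) * (of_nat (r i) * t i) * Var i = t i * Var i"
      by (simp flip: mult.assoc)
    then show "\<delta> (Var i) = lder (\<lambda>i. of_nat (r i) * t i) (Var i)"
      by (simp add: t lder_Var mult.commute)
  qed
  then show ?thesis by blast
qed

text \<open>\<open>comb l\<close> is the coefficient vector with parameters \<open>e2 = l p\<close>, \<open>(e1 - e2) / Q = l q\<close> and \<open>d i = l i\<close>
  otherwise; \<open>d p\<close> and \<open>d q\<close> are determined by the sums over \<open>G\<close> and its complement being 0.\<close>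

definition corr :: "('i \<Rightarrow> ('i, 'k) mpoly) \<Rightarrow> 'i \<Rightarrow> ('i, 'k) mpoly" where
  "corr l i = (if i = p then - sum l (G - {p}) else if i = q then - sum l (- G - {q}) else l i)"

definition comb :: "('i \<Rightarrow> ('i, 'k) mpoly) \<Rightarrow> 'i \<Rightarrow> ('i, 'k) mpoly" where
  "comb l i = l p + (if i \<in> G then 0 else Q * l q) + corr l i * y i"

lemma sum_corr: "sum (corr l) G = 0" "sum (corr l) (- G) = 0"
proof -
  have "sum (corr l) (G - {p}) = sum l (G - {p})" "sum (corr l) (- G - {q}) = sum l (- G - {q})"
    by (rule sum.cong[OF refl], use p q in \<open>auto simp: corr_def split: if_splits\<close>)+
  moreover have "corr l p = - sum l (G - {p})" "corr l q = - sum l (- G - {q})"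
    using p q by (auto simp: corr_def)
  ultimately show "sum (corr l) G = 0" "sum (corr l) (- G) = 0"
    using sum.remove[of G p "corr l"] sum.remove[of "- G" q "corr l"] p q by auto
qed

lemma comb_sums:
  "(\<Sum>i\<in>G. comb l i * hat G i) = l p * g2"
  "(\<Sum>i\<in>-G. comb l i * hat (- G) i) = (l p + Q * l q) * g1"
  by (rule syzygyI[of _ _ _ "corr l"]; simp add: comb_def sum_corr)+

lemma comb_in_Der: "lder (comb l) \<in> Der (F * Q)"
  unfolding lder_in_Der_iff
  by (rule exI[of _ "l p + Q * l q"], rule exI[of _ "l p"]) (simp add: comb_sums)

lemma comb_exhaust:
  assumes "lder c \<in> Der (F * Q)"
  shows "\<exists>l. c = comb l"
proof -
  obtain e1 e2 where e: "(\<Sum>i\<in>G. c i * hat G i) = e2 * g2"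
    "(\<Sum>i\<in>-G. c i * hat (- G) i) = e1 * g1" "Q dvd e1 - e2"
    using assms unfolding lder_in_Der_iff by blast
  obtain d2 where d2: "\<And>i. i \<in> G \<Longrightarrow> c i = e2 + d2 i * y i" "sum d2 G = 0"
    using syzygyE[OF e(1)] by blast
  obtain d1 where d1: "\<And>i. i \<in> - G \<Longrightarrow> c i = e1 + d1 i * y i" "sum d1 (- G) = 0"
    using syzygyE[OF e(2)] by blast
  obtain t where "e1 - e2 = Q * t" using e(3) by blast
  then have t: "e1 = e2 + Q * t" by (simp add: diff_eq_eq add.commute)
  \<comment> \<open>The entries of \<open>d2\<close> at \<open>p\<close> and of \<open>d1\<close> at
    \<open>q\<close> are forced by the vanishing sums, which frees these two positions for
    \<open>e2\<close> and \<open>t\<close>.\<close>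
  define l where "l i = (if i = p then e2 else if i = q then t else if i \<in> G then d2 i else d1 i)" for i
  have "sum l (G - {p}) = sum d2 (G - {p})" "sum l (- G - {q}) = sum d1 (- G - {q})"
    by (rule sum.cong[OF refl], use p q in \<open>auto simp: l_def split: if_splits\<close>)+
  moreover have "sum d2 (G - {p}) = - d2 p" "sum d1 (- G - {q}) = - d1 q"
    using d1(2) d2(2) p q sum.remove[of G p d2] sum.remove[of "- G" q d1]
    by (simp_all add: eq_neg_iff_add_eq_0 add.commute)
  ultimately have corr: "corr l i = (if i \<in> G then d2 i else d1 i)" for i
    using p q by (auto simp: corr_def l_def)
  have "c i = comb l i" for i
    using p q d1(1)[of i] d2(1)[of i] t
    by (auto simp: comb_def corr) (auto simp: l_def)
  then show ?thesis by blast
qed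

text \<open>The weighted sums in \<open>comb_sums\<close> recover \<open>l p\<close> and, as
  \<open>Q\<close> is nonzero, \<open>l q\<close>. The remaining parameters are then read off
  through the nonzero \<open>y j\<close>.\<close>

lemma comb_eq_0:
  assumes "\<And>i. comb l i = 0"
  shows "l j = 0"
proof -
  have lp: "l p = 0" using comb_sums(1)[of l] g_nonzero by (simp add: assms)
  have lq: "l q = 0" using comb_sums(2)[of l] g_nonzero Q_nonzero by (simp add: assms lp)
  have "corr l j * y j = 0" using assms[of j] unfolding comb_def lp lq by (cases "j \<in> G") simp_all
  then have "corr l j = 0" by (simp add: y_nonzero)
  then show ?thesis using lp lq by (auto simp: corr_def split: if_splits)
qed

section \<open>The basis of the module of logarithmic derivations\<close>

definition unit_vec :: "'i \<Rightarrow> 'i \<Rightarrow> ('i, 'k) mpoly" where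
  "unit_vec j k = (if k = j then 1 else 0)"

lemma comb_linear: "comb l i = (\<Sum>j\<in>UNIV. l j * comb (unit_vec j) i)"
proof -
  have u: "(\<Sum>j\<in>UNIV. l j * unit_vec j k) = l k" for k
    using sum.delta[of UNIV k l] by (simp add: unit_vec_def if_distrib cong: if_cong)
  have "(\<Sum>j\<in>UNIV. l j * sum (unit_vec j) A) = sum l A" for A
    unfolding sum_distrib_left by (subst sum.swap) (simp add: u)
  then have c: "(\<Sum>j\<in>UNIV. l j * corr (unit_vec j) i) = corr l i"
    by (simp add: corr_def u sum_negf)
  have "(\<Sum>j\<in>UNIV. l j * comb (unit_vec j) i) = (\<Sum>j\<in>UNIV. l j * unit_vec j p) +
    (if i \<in> G then 0 else Q * (\<Sum>j\<in>UNIV. l j * unit_vec j q)) + (\<Sum>j\<in>UNIV. l j * corr (unit_vec j) i) * y i"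
    by (simp add: comb_def distrib_left sum.distrib sum_distrib_left sum_distrib_right mult_ac)
  then show ?thesis by (simp add: c u comb_def)
qed

lemma lder_comb: "lder (comb l) = (\<Sum>j\<in>UNIV. fun_scale (l j) (lder (comb (unit_vec j))))"
proof (rule derivation_eqI[OF derivation_lder derivation_sum_scale[OF derivation_lder]])
  fix i
  show "lder (comb l) (Var i) = (\<Sum>j\<in>UNIV. fun_scale (l j) (lder (comb (unit_vec j)))) (Var i)"
    unfolding sum_scale_apply lder_Var comb_linear[of l i]
    by (simp add: sum_distrib_left sum_distrib_right mult_ac)
qed

text \<open>The basis has one member per variable. A vanishing combination has
  \<open>comb l i = 0\<close> for all \<open>i\<close>, by evaluation at the variables.\<close>

theorem free_divisor_F_Q: "free_divisor (F * Q)"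
  unfolding free_divisor_def
proof (intro conjI squarefree_F_Q free_submoduleI[of _ "\<lambda>j. lder (comb (unit_vec j))"] subspace_Der comb_in_Der)
  fix \<delta> assume "\<delta> \<in> Der (F * Q)"
  then show "\<exists>l. \<delta> = (\<Sum>j\<in>UNIV. fun_scale (l j) (lder (comb (unit_vec j))))"
    using Der_eq_lder comb_exhaust lder_comb by metis
next
  fix l j assume "(\<Sum>j\<in>UNIV. fun_scale (l j) (lder (comb (unit_vec j)))) = 0"
  then have z: "lder (comb l) (Var i) = 0" for i by (simp flip: lder_comb)
  have "comb l i = 0" for i using z[of i] r_pos[of i] by (simp add: lder_Var)
  then show "l j = 0" by (rule comb_eq_0)
qed

theorem is_red_F: "is_red (f1 * f2) F"
proof (rule is_redI[OF F_nonzero squarefree_F])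
  have Var: "Var p dvd F"
    unfolding F_def by (intro dvd_mult2 dvd_prodI) auto
  show "\<not> F dvd 1"
    using dvd_trans[OF Var, of 1] prime_elem_not_unit[OF prime_elem_Var] by blast
  have f: "f1 * f2 = prod y UNIV * g2 * g1"
  proof -
    have "prod y UNIV = prod y G * prod y (- G)"
      by (subst prod.union_disjoint[symmetric]) (auto simp: Un_commute Compl_partition)
    then show ?thesis unfolding f1_eq f2_eq by (simp only: mult_ac)
  qed
  show "F dvd f1 * f2"
    unfolding f F_def by (intro mult_dvd_mono prod_dvd_prod dvd_refl) (simp add: Var_dvd_y_iff)
  fix t :: "('i, 'k) mpoly" assume t: "irreducible t" "t dvd f1 * f2"
  have pr: "prime_elem t" using t(1) by (rule irreducible_imp_prime_elem)
  have "t dvd prod y UNIV \<or> t dvd g2 \<or> t dvd g1"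
    using t(2) unfolding f prime_elem_dvd_mult_iff[OF pr] by simp
  \<comment> \<open>A prime dividing a power of a variable divides the variable, so replacing
    \<open>y i\<close> by \<open>Var i\<close> loses no irreducible factor.\<close>
  moreover have "t dvd prod Var UNIV" if ty: "t dvd prod y UNIV"
  proof -
    obtain i where "t dvd y i" using prime_elem_dvd_prod[OF pr ty] by blast
    then have "t dvd Var i" unfolding y_def[of i] by (rule prime_elem_dvd_power[OF pr])
    then show ?thesis by (rule dvd_trans) (intro dvd_prodI; simp)
  qed
  ultimately show "t dvd F" unfolding F_def prime_elem_dvd_mult_iff[OF pr] by blast
qed

end

section \<open>The open set of tuples with nonzero coordinates\<close>

text \<open>The product of all homogeneous coordinates, of degree 2 in each factor; it is nonzero
  exactly where no coordinate vanishes.\<close>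

definition coord_monom :: "nat set \<Rightarrow> (nat + nat, 'k::field) mpoly" where
  "coord_monom I = Poly_Mapping.single
     (\<Sum>i\<in>I. Poly_Mapping.single (Inl i) 1 + Poly_Mapping.single (Inr i) 1) 1"

definition nonzero_tuples :: "nat set \<Rightarrow> (nat \<Rightarrow> ('k::field \<times> 'k) set) set" where
  "nonzero_tuples I = {P \<in> proj_tuples I. \<not> vanishes_at I (coord_monom I) P}"

lemma lookup_coord_exponent:
  assumes "finite I"
  shows "Poly_Mapping.lookup
    (\<Sum>i\<in>I. Poly_Mapping.single (Inl i :: nat + nat) (1::nat) + Poly_Mapping.single (Inr i) 1) j =
    (if j \<in> Inl ` I \<union> Inr ` I then 1 else 0)"
proof -
  have "Poly_Mapping.lookup
    (\<Sum>i\<in>I. Poly_Mapping.single (Inl i :: nat + nat) (1::nat) + Poly_Mapping.single (Inr i) 1) j =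
    (\<Sum>i\<in>I. (if j = Inl i then 1 else 0) + (if j = Inr i then 1 else 0))"
    by (auto simp: lookup_sum lookup_add lookup_single when_def intro!: sum.cong)
  also have "\<dots> = (if j \<in> Inl ` I \<union> Inr ` I then 1 else 0)"
    using assms by (cases j) (auto simp: sum.delta)
  finally show ?thesis .
qed

lemma eval_coord_monom:
  assumes "finite I"
  shows "eval_mpoly (case_sum a b) (coord_monom I) \<noteq> 0 \<longleftrightarrow> (\<forall>i\<in>I. a i \<noteq> 0 \<and> b i \<noteq> 0)"
proof -
  define e where
    "e = (\<Sum>i\<in>I. Poly_Mapping.single (Inl i :: nat + nat) (1::nat) + Poly_Mapping.single (Inr i) 1)"
  have e: "Poly_Mapping.lookup e j = (if j \<in> Inl ` I \<union> Inr ` I then 1 else 0)" for j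
    unfolding e_def by (rule lookup_coord_exponent[OF assms])
  then have keys: "Poly_Mapping.keys e = Inl ` I \<union> Inr ` I"
    by (auto simp: in_keys_iff split: if_splits)
  have "eval_mpoly (case_sum a b) (coord_monom I) = (\<Prod>j\<in>Inl ` I \<union> Inr ` I. case_sum a b j)"
    unfolding eval_mpoly_def coord_monom_def e_def[symmetric] by (simp add: keys e)
  also have "\<dots> \<noteq> 0 \<longleftrightarrow> (\<forall>j\<in>Inl ` I \<union> Inr ` I. case_sum a b j \<noteq> 0)"
    using assms by (simp add: prod_zero_iff)
  finally show ?thesis by (simp add: ball_Un ball_conj_distrib)
qed

lemma zariski_open_nonzero_tuples:
  assumes "finite I"
  shows "zariski_open I (nonzero_tuples I :: (nat \<Rightarrow> ('k::field \<times> 'k) set) set)"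
proof -
  have "multihomogeneous I (coord_monom I :: (nat + nat, 'k) mpoly)"
    unfolding multihomogeneous_def coord_monom_def
    using lookup_coord_exponent[OF assms]
    by (intro exI[of _ "\<lambda>_. 2"]) (auto simp: in_keys_iff split: if_splits)
  moreover have "proj_tuples I - nonzero_tuples I =
      {P \<in> proj_tuples I. \<forall>p\<in>{coord_monom I :: (nat + nat, 'k) mpoly}. vanishes_at I p P}"
    by (auto simp: nonzero_tuples_def)
  ultimately have "zariski_closed I (proj_tuples I - nonzero_tuples I :: (nat \<Rightarrow> ('k \<times> 'k) set) set)"
    unfolding zariski_closed_def by blast
  then show ?thesis by (auto simp: zariski_open_def nonzero_tuples_def)
qed

lemma nonzero_tuples_nonempty:
  assumes "finite I"
  shows "nonzero_tuples I \<noteq> ({} :: (nat \<Rightarrow> ('k::field \<times> 'k) set) set)"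
proof -
  \<comment> \<open>The witness is the tuple with the point [1;1] in every factor.\<close>
  have "(\<lambda>i\<in>I. proj_point 1 1) \<in> (proj_tuples I :: (nat \<Rightarrow> ('k \<times> 'k) set) set)"
    by (auto simp: proj_tuples_def proj_line_def intro!: exI[of _ 1])
  moreover have "\<not> vanishes_at I (coord_monom I :: (nat + nat, 'k) mpoly) (\<lambda>i\<in>I. proj_point 1 1)"
  proof
    assume *: "vanishes_at I (coord_monom I :: (nat + nat, 'k) mpoly) (\<lambda>i\<in>I. proj_point 1 1)"
    have "(1, 1) \<in> proj_point (1 :: 'k) 1" by (auto simp: proj_point_def)
    then have "eval_mpoly (case_sum (\<lambda>_. 1) (\<lambda>_. 1 :: 'k)) (coord_monom I) = 0"
      by (intro *[unfolded vanishes_at_def, rule_format]) simp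
    then show False using eval_coord_monom[OF assms, of "\<lambda>_. 1 :: 'k" "\<lambda>_. 1"] one_neq_zero by blast
  qed
  ultimately show ?thesis unfolding nonzero_tuples_def by blast
qed

text \<open>Non-vanishing supplies some representatives with nonzero coordinates; the given ones
  differ from them by nonzero scalars.\<close>

lemma nonzero_tuplesD:
  assumes "finite I" "(\<lambda>i\<in>I. proj_point (a i) (b i)) \<in> nonzero_tuples I" "i \<in> I"
  shows "a i \<noteq> 0 \<and> b i \<noteq> 0"
proof -
  obtain a' b' where *: "\<And>i. i \<in> I \<Longrightarrow> (a' i, b' i) \<in> proj_point (a i) (b i)"
    "eval_mpoly (case_sum a' b') (coord_monom I) \<noteq> 0"
    using assms(2) by (auto simp: nonzero_tuples_def vanishes_at_def)
  then have "a' i \<noteq> 0 \<and> b' i \<noteq> 0" using eval_coord_monom[OF assms(1)] assms(3) by blast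
  then show ?thesis using *(1)[OF assms(3)] by (auto simp: proj_point_def)
qed

text \<open>Used in contrapositive form: distinct points have nonzero determinant, the condition
  \<open>distinct\<close> of the pencil.\<close>

lemma proj_point_eqI:
  assumes "a \<noteq> 0" "c \<noteq> 0" "a * d = c * b"
  shows "proj_point a b = proj_point c d"
proof -
  have d: "d = c / a * b" "c = c / a * a" using assms by (simp_all add: field_simps)
  have "proj_point (t * a) (t * b) = proj_point a b" if "t \<noteq> 0" for t
  proof (intro set_eqI iffI)
    fix P assume "P \<in> proj_point (t * a) (t * b)"
    then obtain s where "s \<noteq> 0" "P = (s * (t * a), s * (t * b))" by (auto simp: proj_point_def)
    then show "P \<in> proj_point a b"
      unfolding proj_point_def using that by (intro CollectI exI[of _ "s * t"]) simp
  next
    fix P assume "P \<in> proj_point a b"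
    then obtain s where "s \<noteq> 0" "P = (s * a, s * b)" by (auto simp: proj_point_def)
    then show "P \<in> proj_point (t * a) (t * b)"
      unfolding proj_point_def using that by (intro CollectI exI[of _ "s / t"]) simp
  qed
  from this[of "c / a"] show ?thesis using assms(1,2) d by simp
qed

section \<open>Transfer to the variables \<open>x 0\<close>, ..., \<open>x n\<close> and to general
  points\<close>

theorem corollary6p23:
  fixes n m :: nat
    and r :: "nat \<Rightarrow> nat"
    and v :: "nat \<Rightarrow> 'i::{finite, linorder}"
    and x h :: "nat \<Rightarrow> ('i, 'k::field_char_0) mpoly"
    and f1 f2 F :: "('i, 'k) mpoly"
  assumes "n \<ge> 1" and "m \<le> n - 1"
    and "\<And>i. i \<le> n \<Longrightarrow> r i > 0"
    \<comment> \<open>the variables are exactly \<open>x 0, \<dots>, x n\<close>\<close>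
    and "bij_betw v {0..n} UNIV"
    and "\<And>i. x i = Var (v i)"
    and "\<And>i. h i = (\<Prod>j\<in>{0..n} - {i}. x j ^ r j)"
    and "f1 = (\<Sum>i\<in>{m+1..n}. h i)"
    and "f2 = (\<Sum>i\<in>{0..m}. h i)"
    and "F = (\<Prod>i\<in>{0..n}. x i)
             * (\<Sum>i\<in>{0..m}. \<Prod>j\<in>{0..m} - {i}. x j ^ r j)
             * (\<Sum>i\<in>{m+1..n}. \<Prod>j\<in>{m+1..n} - {i}. x j ^ r j)"
  shows "(is_red (f1 * f2) F \<and> free_divisor F) \<and>
    (\<forall>k\<ge>3. \<exists>U :: (nat \<Rightarrow> ('k \<times> 'k) set) set.
       zariski_open {3..k} U \<and> U \<noteq> {} \<and>
       (\<forall>a b :: nat \<Rightarrow> 'k.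
          (\<forall>i\<in>{3..k}. (a i, b i) \<noteq> (0, 0)) \<and>
          inj_on (\<lambda>i. proj_point (a i) (b i)) {3..k} \<and>
          (\<lambda>i\<in>{3..k}. proj_point (a i) (b i)) \<in> U \<longrightarrow>
          (\<forall>i\<in>{3..k}. a i \<noteq> 0 \<and> b i \<noteq> 0) \<and>
          free_divisor (F * (\<Prod>i\<in>{3..k}. Const (a i) * f1 + Const (b i) * f2))))"
proof -
  \<comment> \<open>The exponents are carried along \<open>v\<close> from the numbers up to
    \<open>n\<close> to the index type of the variables.\<close>
  define s where "s i = r (inv_into {0..n} v i)" for i
  define y :: "'i \<Rightarrow> ('i, 'k) mpoly" where "y i = Var i ^ s i" for i
  define G where "G = v ` {0..m}"
  have inj: "inj_on v {0..n}" and surj: "v ` {0..n} = UNIV"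
    using assms(4) by (auto simp: bij_betw_def)
  have mn: "m < n" using assms(1,2) by linarith
  have s_pos: "s i > 0" for i
  proof -
    have "inv_into {0..n} v i \<in> {0..n}" by (rule inv_into_into) (simp add: surj)
    then show ?thesis unfolding s_def using assms(3) by simp
  qed
  have y: "y (v i) = x i ^ r i" if "i \<le> n" for i
    using that inj by (simp add: y_def s_def assms(5))
  have compl: "- G = v ` {m+1..n}"
  proof -
    have "{m+1..n} = {0..n} - {0..m}" using mn by auto
    then have "v ` {m+1..n} = v ` {0..n} - v ` {0..m}"
      using inj_on_image_set_diff[OF inj, of "{0..n}" "{0..m}"] mn by auto
    then show ?thesis by (simp add: G_def surj Compl_eq_Diff_UNIV)
  qed
  have hs: "hat_sums s y" by unfold_locales (simp_all add: s_pos y_def)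
  have hsum: "hat_sums.hsum y (v ` A) (v ` B) = (\<Sum>i\<in>B. \<Prod>j\<in>A - {i}. x j ^ r j)"
    if A: "A \<subseteq> {0..n}" and B: "B \<subseteq> {0..n}" for A B
  proof -
    have "hat_sums.hat y (v ` A) (v i) = (\<Prod>j\<in>A - {i}. x j ^ r j)" if "i \<in> B" for i
    proof -
      have i: "i \<in> {0..n}" using that B by blast
      have "v ` A - {v i} = v ` (A - {i})"
        using i A inj_on_eq_iff[OF inj] by blast
      moreover have "inj_on v (A - {i})" using inj A by (meson Diff_subset inj_on_subset)
      ultimately have "hat_sums.hat y (v ` A) (v i) = (\<Prod>j\<in>A - {i}. y (v j))"
        by (simp add: hat_sums.hat_def[OF hs] prod.reindex o_def)
      also have "\<dots> = (\<Prod>j\<in>A - {i}. x j ^ r j)"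
        using A by (intro prod.cong refl y) auto
      finally show ?thesis .
    qed
    moreover have "inj_on v B" using inj B by (rule inj_on_subset)
    ultimately show ?thesis
      by (simp add: hat_sums.hsum_def[OF hs] sum.reindex o_def)
  qed
  have f1: "f1 = hat_sums.hsum y UNIV (- G)" and f2: "f2 = hat_sums.hsum y UNIV G"
    using hsum[of "{0..n}" "{m+1..n}"] hsum[of "{0..n}" "{0..m}"] mn
    by (simp_all add: surj compl assms(6-8)) (simp_all add: G_def)
  have pencil: "pencil s y G (v 0) (v n) I a b"
    if "finite I" "\<And>k. k \<in> I \<Longrightarrow> a k \<noteq> 0 \<and> b k \<noteq> 0"
      "\<And>k l. k \<in> I \<Longrightarrow> l \<in> I \<Longrightarrow> k \<noteq> l \<Longrightarrow> a k * b l \<noteq> a l * b k"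
    for I :: "nat set" and a b
  proof (rule pencil.intro[OF hs], unfold_locales)
    have "v n \<in> - G" unfolding compl using mn by auto
    then show "v n \<notin> G" by simp
  qed (use that in \<open>auto simp: G_def\<close>)
  \<comment> \<open>The pencil without members, where \<open>Q = 1\<close>, gives the statements
    about \<open>F\<close> alone.\<close>
  have pencil0: "pencil s y G (v 0) (v n) ({} :: nat set) (\<lambda>_. 1) (\<lambda>_. 1)"
    by (rule pencil) auto
  have F: "F = pencil.F y G"
  proof -
    have "(\<Prod>i\<in>{0..n}. x i) = prod Var UNIV"
      using prod.reindex[OF inj, of "Var :: 'i \<Rightarrow> ('i, 'k) mpoly"] by (simp add: surj assms(5) o_def)
    then show ?thesis
      using hsum[of "{0..m}" "{0..m}"] hsum[of "{m+1..n}" "{m+1..n}"] mn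
      by (simp add: assms(9) pencil.F_def[OF pencil0] compl) (simp add: G_def)
  qed
  have red: "is_red (f1 * f2) F"
    unfolding f1 f2 F by (rule pencil.is_red_F[OF pencil0])
  have free0: "free_divisor F"
    using pencil.free_divisor_F_Q[OF pencil0] by (simp add: F pencil.Q_def[OF pencil0])
  have free: "free_divisor (F * (\<Prod>i\<in>{3..k}. Const (a i) * f1 + Const (b i) * f2))"
    if ab: "\<And>i. i \<in> {3..k} \<Longrightarrow> a i \<noteq> 0 \<and> b i \<noteq> 0"
      and inj_ab: "inj_on (\<lambda>i. proj_point (a i) (b i)) {3..k}"
    for k and a b :: "nat \<Rightarrow> 'k"
  proof -
    have p: "pencil s y G (v 0) (v n) {3..k} a b"
    proof (rule pencil)
      fix i j assume "i \<in> {3..k}" "j \<in> {3..k}" "i \<noteq> j"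
      then show "a i * b j \<noteq> a j * b i"
        using proj_point_eqI[of "a i" "a j" "b j" "b i"] ab inj_onD[OF inj_ab] by blast
    qed (use ab in auto)
    have "pencil.P y G a b = (\<lambda>i. Const (a i) * f1 + Const (b i) * f2)"
      by (rule ext) (simp add: pencil.P_def[OF p] f1 f2)
    then show ?thesis
      using pencil.free_divisor_F_Q[OF p] by (simp only: F pencil.Q_def[OF p])
  qed
  have open_set: "\<exists>U :: (nat \<Rightarrow> ('k \<times> 'k) set) set. zariski_open {3..k} U \<and> U \<noteq> {} \<and>
       (\<forall>a b :: nat \<Rightarrow> 'k.
          (\<forall>i\<in>{3..k}. (a i, b i) \<noteq> (0, 0)) \<and>
          inj_on (\<lambda>i. proj_point (a i) (b i)) {3..k} \<and>
          (\<lambda>i\<in>{3..k}. proj_point (a i) (b i)) \<in> U \<longrightarrow>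
          (\<forall>i\<in>{3..k}. a i \<noteq> 0 \<and> b i \<noteq> 0) \<and>
          free_divisor (F * (\<Prod>i\<in>{3..k}. Const (a i) * f1 + Const (b i) * f2)))" for k
  \<comment> \<open>The open set requires only that all coordinates be nonzero; distinctness comes
    from the injectivity assumption.\<close>
  proof (intro exI[of _ "nonzero_tuples {3..k}"] conjI allI impI; (elim conjE)?)
    fix a b :: "nat \<Rightarrow> 'k"
    assume inj_ab: "inj_on (\<lambda>i. proj_point (a i) (b i)) {3..k}"
      and "(\<lambda>i\<in>{3..k}. proj_point (a i) (b i)) \<in> nonzero_tuples {3..k}"
    then have ab: "a i \<noteq> 0 \<and> b i \<noteq> 0" if "i \<in> {3..k}" for i
      using nonzero_tuplesD[OF _ _ that] by blast
    then show "\<forall>i\<in>{3..k}. a i \<noteq> 0 \<and> b i \<noteq> 0" by blast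
    show "free_divisor (F * (\<Prod>i\<in>{3..k}. Const (a i) * f1 + Const (b i) * f2))"
      using ab inj_ab by (rule free)
  qed (simp_all add: zariski_open_nonzero_tuples nonzero_tuples_nonempty)
  show ?thesis by (intro conjI allI impI red free0 open_set)
qed

end
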